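(* The rank-like rates depend continuously on the relative frequency of each possible content of an individual vote. That is, let $v^1,\dots,v^m\in\Omega$ be the possible individual votes, and for $\alpha$ in the simplex $\Delta=\{\alpha\in[0,1]^m : \sum_k\alpha_k=1\}$ let $v(\alpha)=\sum_{k=1}^m\alpha_k v^k\in\Omega$ be the collective Llull matrix. Then for every $x\in A$ the map $\Delta\ni\alpha\mapsto R_x(v(\alpha))$ is continuous, where $R_x(v)$ denotes the rank-like rate of $x$ obtained from $v$.
   Context: Let $A$ be a finite set of $N\ge 1$ options and $\Pi=\{(x,y)\in A\times A : x\neq y\}$; a pair $(x,y)$ is written $xy$. Let $\Omega=\{v\in[0,1]^{\Pi} : v_{xy}+v_{yx}\le 1 \text{ for all } xy\in\Pi\}$; its elements are called Llull matrices. For $v\in\Omega$ put $t_{xy}=v_{xy}+v_{yx}$ (turnouts). Individual votes are elements of $\Omega$. CLC procedure applied to $v\in\Omega$: (1) Indirect scores: $v^*_{xy}=\max\min_{0\le i<n} v_{x_ix_{i+1}}$, the maximum being over all paths $x_0x_1\dots x_n$ ($n\ge1$, consecutive elements distinct) in $A$ with $x_0=x$, $x_n=y$. Indirect margins: $m^{\kappa}_{xy}=v^*_{xy}-v^*_{yx}$. (2) Indirect comparison relation: $\kappa=\{xy\in\Pi : m^{\kappa}_{xy}>0\}$ (it is transitive). An admissible order is any strict total order $\xi\subseteq\Pi$ on $A$ with $\kappa\subseteq\xi$. Fix an admissible order $\xi$. Write $x\succ_\xi y$ for $xy\in\xi$, and $x\succeq_\xi y$ for ($xy\in\xi$ or $x=y$).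 For $x$ not last in $\xi$, $x'$ denotes the immediate successor of $x$ in $\xi$ (the element following $x$). (3) For each non-last $x$: $m^{\sigma}_{xx'}=\min\{m^{\kappa}_{pq} : p\succeq_\xi x,\ x'\succeq_\xi q\}$. (4) $(t^{\sigma}_{xy})$ is the unique minimizer of $\sum_{x}\sum_{y\neq x}(\tau_{xy}-t_{xy})^2$ over all $\tau\in\mathbb{R}^{\Pi}$ satisfying: $\tau_{xy}=\tau_{yx}$ for all $xy\in\Pi$; $m^{\sigma}_{xx'}\le\tau_{xx'}\le1$ for all non-last $x$; and $0\le\tau_{xz}-\tau_{x'z}\le m^{\sigma}_{xx'}$ for all non-last $x$ and all $z\notin\{x,x'\}$. (5) Projected scores: $v^{\pi}_{xx'}=(t^{\sigma}_{xx'}+m^{\sigma}_{xx'})/2$, $v^{\pi}_{x'x}=(t^{\sigma}_{xx'}-m^{\sigma}_{xx'})/2$, and for $x\succ_\xi y$: $v^{\pi}_{xy}=\max\{v^{\pi}_{pp'} : x\succeq_\xi p\succ_\xi y\}$, $v^{\pi}_{yx}=\min\{v^{\pi}_{p'p} : x\succeq_\xi p\succ_\xi y\}$. (6) Rank-like rates: $R_x=N-\sum_{y\neq x}v^{\pi}_{xy}$. The projected scores and rank-like rates do not depend on the choice of the admissible order $\xi$, so they are functions of $v$. *)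

theory Defs
  imports "HOL-Analysis.Analysis"
begin

text \<open>
  Matrices without diagonal, indexed by ordered pairs of distinct options, are functions on
  pairs that are \<^const>\<open>extensional\<close> on \<open>offdiag A\<close>, so that the minimizer in
  \<open>sigma_turnout\<close> below is unique as a function.
  A strict order is a set of pairs; \<open>(x, y) \<in> \<xi>\<close> means that \<open>x\<close> is preferred to \<open>y\<close>.
\<close>

definition offdiag :: "'a set \<Rightarrow> ('a \<times> 'a) set" where
  "offdiag A = {(x, y). x \<in> A \<and> y \<in> A \<and> x \<noteq> y}"

definition llull_matrices :: "'a set \<Rightarrow> ('a \<times> 'a \<Rightarrow> real) set" where
  "llull_matrices A =
     {v \<in> offdiag A \<rightarrow>\<^sub>E {0..1}. \<forall>(x, y) \<in> offdiag A. v (x, y) + v (y, x) \<le> 1}"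

definition turnout :: "('a \<times> 'a \<Rightarrow> real) \<Rightarrow> 'a \<times> 'a \<Rightarrow> real" where
  "turnout v = (\<lambda>(x, y). v (x, y) + v (y, x))"

definition paths :: "'a set \<Rightarrow> 'a \<Rightarrow> 'a \<Rightarrow> 'a list set" where
  "paths A x y =
     {p. set p \<subseteq> A \<and> length p \<ge> 2 \<and> hd p = x \<and> last p = y \<and> successively (\<noteq>) p}"

definition path_score :: "('a \<times> 'a \<Rightarrow> real) \<Rightarrow> 'a list \<Rightarrow> real" where
  "path_score v p = Min ((\<lambda>i. v (p ! i, p ! Suc i)) ` {i. Suc i < length p})"

text \<open>
  There are infinitely many paths, but for finite \<open>A\<close> their scores form a finite set, so
  \<^const>\<open>Max\<close> is meaningful.
\<close>

definition indirect_score :: "'a set \<Rightarrow> ('a \<times> 'a \<Rightarrow> real) \<Rightarrow> 'a \<times> 'a \<Rightarrow> real" where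
  "indirect_score A v = (\<lambda>(x, y). Max (path_score v ` paths A x y))"

definition indirect_margin :: "'a set \<Rightarrow> ('a \<times> 'a \<Rightarrow> real) \<Rightarrow> 'a \<times> 'a \<Rightarrow> real" where
  "indirect_margin A v = (\<lambda>(x, y). indirect_score A v (x, y) - indirect_score A v (y, x))"

definition indirect_comparison :: "'a set \<Rightarrow> ('a \<times> 'a \<Rightarrow> real) \<Rightarrow> ('a \<times> 'a) set" where
  "indirect_comparison A v = {xy \<in> offdiag A. indirect_margin A v xy > 0}"

text \<open>Irreflexivity is contained in \<open>\<xi> \<subseteq> offdiag A\<close>.\<close>

definition admissible_order ::
    "'a set \<Rightarrow> ('a \<times> 'a \<Rightarrow> real) \<Rightarrow> ('a \<times> 'a) set \<Rightarrow> bool" where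
  "admissible_order A v \<xi> \<longleftrightarrow>
     \<xi> \<subseteq> offdiag A \<and> trans \<xi> \<and> total_on A \<xi> \<and> indirect_comparison A v \<subseteq> \<xi>"

text \<open>
  For a strict total order \<open>\<xi>\<close> on \<open>A\<close>, the elements that are not last are those of
  \<^term>\<open>Domain \<xi>\<close>; \<open>succ_in \<xi>\<close> is only used on them.
\<close>

definition succ_in :: "('a \<times> 'a) set \<Rightarrow> 'a \<Rightarrow> 'a" where
  "succ_in \<xi> x = (THE y. (x, y) \<in> \<xi> \<and> (\<nexists>z. (x, z) \<in> \<xi> \<and> (z, y) \<in> \<xi>))"

text \<open>The superdiagonal margin of the pair \<open>(x, succ_in \<xi> x)\<close>.\<close>

definition sigma_margin ::
    "'a set \<Rightarrow> ('a \<times> 'a \<Rightarrow> real) \<Rightarrow> ('a \<times> 'a) set \<Rightarrow> 'a \<Rightarrow> real" where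
  "sigma_margin A v \<xi> x =
     Min (indirect_margin A v ` {(p, q). (p, x) \<in> \<xi>\<^sup>= \<and> (succ_in \<xi> x, q) \<in> \<xi>\<^sup>=})"

definition sigma_feasible ::
    "'a set \<Rightarrow> ('a \<times> 'a \<Rightarrow> real) \<Rightarrow> ('a \<times> 'a) set \<Rightarrow> ('a \<times> 'a \<Rightarrow> real) set" where
  "sigma_feasible A v \<xi> =
     {\<tau> \<in> offdiag A \<rightarrow>\<^sub>E UNIV.
        (\<forall>(x, y) \<in> offdiag A. \<tau> (x, y) = \<tau> (y, x)) \<and>
        (\<forall>x \<in> Domain \<xi>.
           sigma_margin A v \<xi> x \<le> \<tau> (x, succ_in \<xi> x) \<and> \<tau> (x, succ_in \<xi> x) \<le> 1) \<and>
        (\<forall>x \<in> Domain \<xi>. \<forall>z \<in> A - {x, succ_in \<xi> x}.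
           0 \<le> \<tau> (x, z) - \<tau> (succ_in \<xi> x, z) \<and>
           \<tau> (x, z) - \<tau> (succ_in \<xi> x, z) \<le> sigma_margin A v \<xi> x)}"

definition sigma_turnout ::
    "'a set \<Rightarrow> ('a \<times> 'a \<Rightarrow> real) \<Rightarrow> ('a \<times> 'a) set \<Rightarrow> 'a \<times> 'a \<Rightarrow> real" where
  "sigma_turnout A v \<xi> =
     (THE \<tau>. is_arg_min (\<lambda>\<tau>. \<Sum>x\<in>A. \<Sum>y\<in>A - {x}. (\<tau> (x, y) - turnout v (x, y))\<^sup>2)
               (\<lambda>\<tau>. \<tau> \<in> sigma_feasible A v \<xi>) \<tau>)"

text \<open>
  The projected scores of consecutive options \<open>x\<close> and \<open>x' = succ_in \<xi> x\<close>:
  \<open>forward_score\<close> is that of \<open>(x, x')\<close>, \<open>backward_score\<close> that of \<open>(x', x)\<close>.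
\<close>

definition forward_score ::
    "'a set \<Rightarrow> ('a \<times> 'a \<Rightarrow> real) \<Rightarrow> ('a \<times> 'a) set \<Rightarrow> 'a \<Rightarrow> real" where
  "forward_score A v \<xi> x =
     (sigma_turnout A v \<xi> (x, succ_in \<xi> x) + sigma_margin A v \<xi> x) / 2"

definition backward_score ::
    "'a set \<Rightarrow> ('a \<times> 'a \<Rightarrow> real) \<Rightarrow> ('a \<times> 'a) set \<Rightarrow> 'a \<Rightarrow> real" where
  "backward_score A v \<xi> x =
     (sigma_turnout A v \<xi> (x, succ_in \<xi> x) - sigma_margin A v \<xi> x) / 2"

text \<open>In the second branch \<open>y\<close> precedes \<open>x\<close>, as \<open>\<xi>\<close> is total and \<open>x \<noteq> y\<close>.\<close>

definition projected_score ::
    "'a set \<Rightarrow> ('a \<times> 'a \<Rightarrow> real) \<Rightarrow> ('a \<times> 'a) set \<Rightarrow> 'a \<times> 'a \<Rightarrow> real" where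
  "projected_score A v \<xi> = (\<lambda>(x, y).
     if (x, y) \<in> \<xi>
     then Max (forward_score A v \<xi> ` {p. (x, p) \<in> \<xi>\<^sup>= \<and> (p, y) \<in> \<xi>})
     else Min (backward_score A v \<xi> ` {p. (y, p) \<in> \<xi>\<^sup>= \<and> (p, x) \<in> \<xi>}))"

definition rate_wrt ::
    "'a set \<Rightarrow> ('a \<times> 'a \<Rightarrow> real) \<Rightarrow> ('a \<times> 'a) set \<Rightarrow> 'a \<Rightarrow> real" where
  "rate_wrt A v \<xi> x = real (card A) - (\<Sum>y\<in>A - {x}. projected_score A v \<xi> (x, y))"

text \<open>
  The value of \<open>rate_wrt\<close> is the same for every admissible order, so the choice made
  here is immaterial.
\<close>

definition rank_like_rate :: "'a set \<Rightarrow> ('a \<times> 'a \<Rightarrow> real) \<Rightarrow> 'a \<Rightarrow> real" where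
  "rank_like_rate A v x = rate_wrt A v (SOME \<xi>. admissible_order A v \<xi>) x"

definition prob_simplex :: "(real ^ 'm) set" where
  "prob_simplex = {\<alpha>. (\<forall>k. 0 \<le> \<alpha> $ k \<and> \<alpha> $ k \<le> 1) \<and> (\<Sum>k\<in>UNIV. \<alpha> $ k) = 1}"

definition collective_matrix ::
    "'a set \<Rightarrow> ('m \<Rightarrow> 'a \<times> 'a \<Rightarrow> real) \<Rightarrow> real ^ 'm \<Rightarrow> 'a \<times> 'a \<Rightarrow> real" where
  "collective_matrix A V \<alpha> = (\<lambda>xy \<in> offdiag A. \<Sum>k\<in>UNIV. \<alpha> $ k * V k xy)"

end

theory Submission
  imports Defs
begin

text \<open>
  For a fixed strict total order \<open>\<xi>\<close>, the set of parameters \<open>\<alpha>\<close> for which \<open>\<xi>\<close> is admissible is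
  closed, since it is cut out by the inequalities \<open>m\<^sup>\<kappa>\<^sub>x\<^sub>y \<le> 0\<close> for \<open>xy \<notin> \<xi>\<close>. These finitely many sets cover
  the simplex, so it suffices that the rates computed with \<open>\<xi>\<close> are continuous on each of them and
  agree on the overlaps.

  Continuity for fixed \<open>\<xi>\<close> is only in question for the projection onto the polytope of turnouts.
  The minimizers stay in a compact set, so it is enough to identify their cluster points, and for
  that one needs every point \<open>\<tau>\<close> of the limit polytope to be a limit of points of the nearby
  polytopes. The points \<open>(1 - s) \<tau> + s\<close> with small \<open>s\<close> do this, because the constant matrix \<open>1\<close> lies in
  all the polytopes.

  Two admissible orders are connected by transpositions of consecutive options \<open>a\<close>, \<open>b\<close> with
  \<open>m\<^sup>\<kappa>\<^sub>a\<^sub>b = 0\<close>. Then \<open>m\<^sup>\<sigma>\<^sub>a\<^sub>b = 0\<close>, so every feasible \<open>\<tau>\<close> has equal rows \<open>a\<close> and \<open>b\<close>; hence the transposition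
  preserves the polytope, its minimizer, and finally the projected scores.
\<close>

section \<open>Strict total orders on finite sets\<close>

locale finite_linear_order =
  fixes A :: "'a set" and \<xi> :: "('a \<times> 'a) set"
  assumes finite_carrier: "finite A"
    and subset_offdiag: "\<xi> \<subseteq> offdiag A"
    and trans_order: "trans \<xi>"
    and total_order: "total_on A \<xi>"
begin

lemma lessD:
  assumes "(x, y) \<in> \<xi>"
  shows "x \<in> A" "y \<in> A" "x \<noteq> y"
  using assms subset_offdiag by (auto simp: offdiag_def)

lemma less_trans: "(x, y) \<in> \<xi> \<Longrightarrow> (y, z) \<in> \<xi> \<Longrightarrow> (x, z) \<in> \<xi>"
  using trans_order by (rule transD)

lemma asym: "(x, y) \<in> \<xi> \<Longrightarrow> (y, x) \<notin> \<xi>"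
  using less_trans lessD(3) by blast

lemma linear: "x \<in> A \<Longrightarrow> y \<in> A \<Longrightarrow> x \<noteq> y \<Longrightarrow> (x, y) \<notin> \<xi> \<Longrightarrow> (y, x) \<in> \<xi>"
  using total_order by (auto simp: total_on_def)

lemma finite_order: "finite \<xi>"
proof -
  have "\<xi> \<subseteq> A \<times> A" using lessD by auto
  then show ?thesis using finite_carrier finite_subset by blast
qed

lemma acyclic: "acyclic \<xi>"
  using trans_order lessD(3) by (auto simp: acyclic_def trancl_id)

lemma wf: "wf \<xi>"
  using finite_order acyclic by (rule finite_acyclic_wf)

lemma wf_converse: "wf (\<xi>\<inverse>)"
  using finite_order acyclic by (rule finite_acyclic_wf_converse)

text \<open>Successors are certified by leastness: a competing \<open>y'\<close> equals
  \<open>y\<close> or lies above it, and in the latter case \<open>y\<close> would be between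
  \<open>x\<close> and \<open>y'\<close>.\<close>

lemma succ_in_eqI:
  assumes "(x, y) \<in> \<xi>" and "\<And>z. (x, z) \<in> \<xi> \<Longrightarrow> (y, z) \<in> \<xi>\<^sup>="
  shows "succ_in \<xi> x = y"
  unfolding succ_in_def
proof (rule the_equality)
  show "(x, y) \<in> \<xi> \<and> (\<nexists>z. (x, z) \<in> \<xi> \<and> (z, y) \<in> \<xi>)"
    using assms asym lessD(3) by blast
  show "y' = y" if "(x, y') \<in> \<xi> \<and> (\<nexists>z. (x, z) \<in> \<xi> \<and> (z, y') \<in> \<xi>)" for y'
    using that assms by blast
qed

lemma ex_succ:
  assumes "x \<in> Domain \<xi>"
  shows "\<exists>y. (x, y) \<in> \<xi> \<and> (\<forall>z. (x, z) \<in> \<xi> \<longrightarrow> (y, z) \<in> \<xi>\<^sup>=)"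
proof -
  have "{y. (x, y) \<in> \<xi>} \<noteq> {}" using assms by auto
  from wfE_min'[OF wf this]
  obtain y where y: "(x, y) \<in> \<xi>" "\<And>z. (z, y) \<in> \<xi> \<Longrightarrow> (x, z) \<notin> \<xi>"
    by (metis mem_Collect_eq)
  have "(y, z) \<in> \<xi>\<^sup>=" if "(x, z) \<in> \<xi>" for z
    using that y linear[of z y] lessD by auto
  then show ?thesis using y(1) by blast
qed

lemma
  assumes "x \<in> Domain \<xi>"
  shows less_succ: "(x, succ_in \<xi> x) \<in> \<xi>"
    and succ_least: "(x, z) \<in> \<xi> \<Longrightarrow> (succ_in \<xi> x, z) \<in> \<xi>\<^sup>="
proof -
  obtain y where y: "(x, y) \<in> \<xi>" "\<And>z. (x, z) \<in> \<xi> \<Longrightarrow> (y, z) \<in> \<xi>\<^sup>="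
    using ex_succ[OF assms] by blast
  then have "succ_in \<xi> x = y" by (rule succ_in_eqI)
  with y show "(x, succ_in \<xi> x) \<in> \<xi>" "(x, z) \<in> \<xi> \<Longrightarrow> (succ_in \<xi> x, z) \<in> \<xi>\<^sup>="
    by auto
qed

lemma less_succ_iff:
  assumes "x \<in> Domain \<xi>"
  shows "(p, succ_in \<xi> x) \<in> \<xi> \<longleftrightarrow> (p, x) \<in> \<xi>\<^sup>="
proof
  assume "(p, succ_in \<xi> x) \<in> \<xi>"
  then show "(p, x) \<in> \<xi>\<^sup>="
    using succ_least[OF assms, of p] linear[of p x] less_succ[OF assms] lessD asym by blast
next
  assume "(p, x) \<in> \<xi>\<^sup>="
  then show "(p, succ_in \<xi> x) \<in> \<xi>"
    using less_succ[OF assms] less_trans by blast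
qed

lemma ex_pred:
  assumes "(x, y) \<in> \<xi>"
  obtains p where "(x, p) \<in> \<xi>\<^sup>=" "(p, y) \<in> \<xi>" "succ_in \<xi> p = y"
proof -
  have "{p. (p, y) \<in> \<xi>} \<noteq> {}" using assms by auto
  from wfE_min'[OF wf_converse this]
  obtain p where p: "(p, y) \<in> \<xi>" "\<And>z. (p, z) \<in> \<xi> \<Longrightarrow> (z, y) \<notin> \<xi>"
    by (metis mem_Collect_eq converse_iff)
  have "succ_in \<xi> p = y"
    using p(1)
  proof (rule succ_in_eqI)
    show "(y, z) \<in> \<xi>\<^sup>=" if "(p, z) \<in> \<xi>" for z
      using p that linear[of z y] lessD by auto
  qed
  moreover have "(x, p) \<in> \<xi>\<^sup>="
    using p(2)[of x] p(1) assms linear[of p x] lessD by auto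
  ultimately show thesis using that p by blast
qed

text \<open>A pair of \<open>\<eta>\<close> missing from \<open>\<xi>\<close> is reversed in
  \<open>\<xi>\<close>, hence also in \<open>\<eta>\<close>, against asymmetry.\<close>

lemma subset_eq:
  assumes "finite_linear_order A \<eta>" and "\<xi> \<subseteq> \<eta>"
  shows "\<xi> = \<eta>"
proof
  interpret \<eta>: finite_linear_order A \<eta> by fact
  show "\<eta> \<subseteq> \<xi>"
  proof clarify
    fix x y assume "(x, y) \<in> \<eta>"
    then show "(x, y) \<in> \<xi>"
      using linear[of x y] \<eta>.asym \<eta>.lessD assms(2) by blast
  qed
qed fact

text \<open>A finite total order is generated by its consecutive pairs. Read contrapositively, this
  yields a consecutive pair on which two different admissible orders disagree.\<close>

lemma subset_if_succ_subset:
  assumes "trans \<eta>" and "\<And>x. x \<in> Domain \<xi> \<Longrightarrow> (x, succ_in \<xi> x) \<in> \<eta>"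
  shows "\<xi> \<subseteq> \<eta>"
proof -
  have "(x, y) \<in> \<xi> \<Longrightarrow> (x, y) \<in> \<eta>" for x y
    \<comment> \<open>Induction from the last option downwards: the hypothesis covers every option
      after \<open>x\<close>, in particular its successor.\<close>
    using wf_converse
  proof (induction x rule: wf_induct_rule)
    case (less x)
    have x: "x \<in> Domain \<xi>" using less.prems by blast
    show ?case
    proof (cases "y = succ_in \<xi> x")
      case False
      then have "(succ_in \<xi> x, y) \<in> \<xi>" using succ_least[OF x less.prems] by auto
      then have "(succ_in \<xi> x, y) \<in> \<eta>" using less.IH less_succ[OF x] by blast
      then show ?thesis using assms x by (blast dest: transD)
    qed (use assms x in auto)
  qed
  then show ?thesis by auto
qed

end

lemma admissible_imp_linear:
  assumes "finite A" and "admissible_order A v \<xi>"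
  shows "finite_linear_order A \<xi>"
  using assms by (simp add: finite_linear_order_def admissible_order_def)

section \<open>Indirect scores and admissible orders\<close>

lemma finite_offdiag: "finite A \<Longrightarrow> finite (offdiag A)"
  by (rule finite_subset[of _ "A \<times> A"]) (auto simp: offdiag_def)

lemma offdiag_swap: "(x, y) \<in> offdiag A \<Longrightarrow> (y, x) \<in> offdiag A"
  by (auto simp: offdiag_def)

section \<open>Path scores and indirect scores through thresholds\<close>

lemma path_edge:
  assumes "p \<in> paths A x y" and "Suc i < length p"
  shows "(p ! i, p ! Suc i) \<in> offdiag A"
proof -
  have "p ! i \<in> set p" "p ! Suc i \<in> set p" using assms(2) by auto
  then show ?thesis
    using assms by (auto simp: paths_def offdiag_def successively_conv_nth)
qed

lemma path_edges_nonempty: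
  assumes "p \<in> paths A x y"
  shows "{i. Suc i < length p} \<noteq> {}"
  using assms by (auto simp: paths_def intro!: exI[of _ 0])

lemma finite_path_edges: "finite {i. Suc i < length p}"
  by (rule finite_subset[of _ "{..<length p}"]) auto

lemma le_path_score_iff:
  assumes "p \<in> paths A x y"
  shows "c \<le> path_score v p \<longleftrightarrow> successively (\<lambda>a b. c \<le> v (a, b)) p"
  using finite_path_edges[of p] path_edges_nonempty[OF assms]
  by (auto simp: path_score_def successively_conv_nth)

text \<open>The minimum is attained at some edge. This confines the scores of the infinitely many
  paths to one finite set, so that \<open>Max\<close> can be used.\<close>

lemma path_score_in_image:
  assumes "p \<in> paths A x y"
  shows "path_score v p \<in> v ` offdiag A"
proof -
  have "path_score v p \<in> (\<lambda>i. v (p ! i, p ! Suc i)) ` {i. Suc i < length p}"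
    unfolding path_score_def
    using finite_path_edges[of p] path_edges_nonempty[OF assms] by (intro Min_in) auto
  then show ?thesis using path_edge[OF assms] by auto
qed

context
  fixes A :: "'a set"
  assumes fin: "finite A"
begin

lemma finite_path_scores: "finite (path_score v ` paths A x y)"
  by (rule finite_subset[of _ "v ` offdiag A"])
    (use path_score_in_image finite_offdiag[OF fin] in auto)

lemma paths_nonempty:
  assumes "(x, y) \<in> offdiag A"
  shows "paths A x y \<noteq> {}"
proof -
  have "[x, y] \<in> paths A x y" using assms by (auto simp: paths_def offdiag_def)
  then show ?thesis by blast
qed

text \<open>Threshold form of the max-min: it reduces indirect scores to connectivity in the graph
  of edges of weight at least \<open>c\<close>, where paths can be reused for another matrix and
  concatenated.\<close>

lemma le_indirect_score_iff:
  assumes "(x, y) \<in> offdiag A"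
  shows "c \<le> indirect_score A v (x, y) \<longleftrightarrow>
    (\<exists>p\<in>paths A x y. successively (\<lambda>a b. c \<le> v (a, b)) p)"
proof -
  have "c \<le> indirect_score A v (x, y) \<longleftrightarrow> (\<exists>p\<in>paths A x y. c \<le> path_score v p)"
    using finite_path_scores[of v x y] paths_nonempty[OF assms]
    by (auto simp: indirect_score_def Max_ge_iff)
  then show ?thesis by (simp add: le_path_score_iff cong: bex_cong)
qed

lemma indirect_score_in_image:
  assumes "xy \<in> offdiag A"
  shows "indirect_score A v xy \<in> v ` offdiag A"
proof -
  obtain x y where xy: "xy = (x, y)" by fastforce
  have "indirect_score A v xy \<in> path_score v ` paths A x y"
    using finite_path_scores[of v x y] paths_nonempty[of x y] assms
    unfolding xy indirect_score_def by simp
  then show ?thesis using path_score_in_image by auto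
qed

text \<open>A path that is optimal for \<open>v\<close> is also a path for \<open>w\<close>, and
  each of its edges loses at most \<open>\<epsilon>\<close>. Used in both directions, this makes the
  indirect scores 1-Lipschitz in the sup norm, even where the optimal path jumps.\<close>

lemma indirect_score_perturbation:
  assumes "\<And>e. e \<in> offdiag A \<Longrightarrow> v e \<le> w e + \<epsilon>" and xy: "xy \<in> offdiag A"
  shows "indirect_score A v xy \<le> indirect_score A w xy + \<epsilon>"
proof -
  obtain x y where [simp]: "xy = (x, y)" by fastforce
  let ?c = "indirect_score A v xy"
  have off: "(x, y) \<in> offdiag A" using xy by simp
  obtain p where p: "p \<in> paths A x y" "successively (\<lambda>a b. ?c \<le> v (a, b)) p"
    using le_indirect_score_iff[OF off, of ?c v] by auto
  have "successively (\<lambda>a b. ?c - \<epsilon> \<le> w (a, b)) p"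
    unfolding successively_conv_nth
  proof clarify
    fix i assume i: "Suc i < length p"
    have "?c \<le> v (p ! i, p ! Suc i)" using p(2) i by (simp add: successively_conv_nth)
    also have "\<dots> \<le> w (p ! i, p ! Suc i) + \<epsilon>" using assms(1) path_edge[OF p(1) i] .
    finally show "?c - \<epsilon> \<le> w (p ! i, p ! Suc i)" by simp
  qed
  then have "?c - \<epsilon> \<le> indirect_score A w (x, y)"
    using le_indirect_score_iff[OF off] p(1) by blast
  then show ?thesis by simp
qed

lemma tendsto_indirect_score:
  assumes lim: "\<And>e. e \<in> offdiag A \<Longrightarrow> ((\<lambda>\<alpha>. v \<alpha> e) \<longlongrightarrow> w e) F"
    and xy: "xy \<in> offdiag A"
  shows "((\<lambda>\<alpha>. indirect_score A (v \<alpha>) xy) \<longlongrightarrow> indirect_score A w xy) F"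
proof (rule tendstoI)
  fix \<epsilon> :: real assume "\<epsilon> > 0"
  \<comment> \<open>Half of \<open>\<epsilon>\<close>, so that the weak bounds of the perturbation
    lemma give the strict inequality required by \<open>tendstoI\<close>.\<close>
  then have "\<forall>\<^sub>F \<alpha> in F. dist (v \<alpha> e) (w e) < \<epsilon> / 2" if "e \<in> offdiag A" for e
    using tendstoD[OF lim[OF that], of "\<epsilon> / 2"] by simp
  then have "\<forall>\<^sub>F \<alpha> in F. \<forall>e\<in>offdiag A. dist (v \<alpha> e) (w e) < \<epsilon> / 2"
    using finite_offdiag[OF fin] by (intro eventually_ball_finite) auto
  then show "\<forall>\<^sub>F \<alpha> in F. dist (indirect_score A (v \<alpha>) xy) (indirect_score A w xy) < \<epsilon>"
  proof eventually_elim
    case (elim \<alpha>)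
    have "v \<alpha> e \<le> w e + \<epsilon> / 2" "w e \<le> v \<alpha> e + \<epsilon> / 2" if "e \<in> offdiag A" for e
      using elim[rule_format, OF that] unfolding dist_real_def by arith+
    then have "indirect_score A (v \<alpha>) xy \<le> indirect_score A w xy + \<epsilon> / 2"
      "indirect_score A w xy \<le> indirect_score A (v \<alpha>) xy + \<epsilon> / 2"
      by (intro indirect_score_perturbation xy; simp)+
    then show ?case using \<open>\<epsilon> > 0\<close> by (auto simp: dist_real_def abs_less_iff)
  qed
qed

lemma tendsto_indirect_margin:
  assumes "\<And>e. e \<in> offdiag A \<Longrightarrow> ((\<lambda>\<alpha>. v \<alpha> e) \<longlongrightarrow> w e) F" and "xy \<in> offdiag A"
  shows "((\<lambda>\<alpha>. indirect_margin A (v \<alpha>) xy) \<longlongrightarrow> indirect_margin A w xy) F"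
proof -
  obtain x y where [simp]: "xy = (x, y)" by fastforce
  show ?thesis
    using assms offdiag_swap[of x y A]
    by (auto simp: indirect_margin_def intro!: tendsto_diff tendsto_indirect_score)
qed

lemma indirect_margin_le_1:
  assumes "\<And>e. e \<in> offdiag A \<Longrightarrow> v e \<in> {0..1}" and "xy \<in> offdiag A"
  shows "indirect_margin A v xy \<le> 1"
proof -
  obtain x y where [simp]: "xy = (x, y)" by fastforce
  have "indirect_score A v (x, y) \<in> {0..1}" "indirect_score A v (y, x) \<in> {0..1}"
    using indirect_score_in_image[of "(x, y)" v] indirect_score_in_image[of "(y, x)" v]
      offdiag_swap[of x y A] assms by auto
  then show ?thesis by (simp add: indirect_margin_def)
qed

section \<open>Transitivity of the indirect comparison and existence of admissible orders\<close>

lemma indirect_score_compose: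
  assumes "(x, y) \<in> offdiag A" "(y, z) \<in> offdiag A" "(x, z) \<in> offdiag A"
    and "c \<le> indirect_score A v (x, y)" and "c \<le> indirect_score A v (y, z)"
  shows "c \<le> indirect_score A v (x, z)"
proof -
  let ?R = "\<lambda>a b. c \<le> v (a, b)"
  obtain p q where p: "p \<in> paths A x y" "successively ?R p"
    and q: "q \<in> paths A y z" "successively ?R q"
    using assms le_indirect_score_iff by blast
  \<comment> \<open>The first entry of \<open>q\<close> is dropped because \<open>y\<close> already
    ends \<open>p\<close>; as \<open>q\<close> has at least two entries, \<open>q'\<close> is
    nonempty and still ends in \<open>z\<close>.\<close>
  obtain q' where q': "q = y # q'" "q' \<noteq> []"
    using q(1) by (cases q) (fastforce simp: paths_def)+
  have "successively (\<noteq>) (p @ q')"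
    using p(1) q(1) q' by (cases q') (auto simp: paths_def successively_append_iff)
  then have "p @ q' \<in> paths A x z"
    using p(1) q(1) q' by (cases p) (auto simp: paths_def)
  moreover have "successively ?R (p @ q')"
    using p q q' by (cases q') (auto simp: paths_def successively_append_iff)
  ultimately show ?thesis using le_indirect_score_iff assms(3) by blast
qed

lemma trans_indirect_comparison: "trans (indirect_comparison A v)"
proof (rule transI)
  fix x y z
  assume xy: "(x, y) \<in> indirect_comparison A v" and yz: "(y, z) \<in> indirect_comparison A v"
  have off: "(x, y) \<in> offdiag A" "(y, x) \<in> offdiag A" "(y, z) \<in> offdiag A" "(z, y) \<in> offdiag A"
    using xy yz offdiag_swap by (auto simp: indirect_comparison_def)
  have "x \<noteq> z" using xy yz by (auto simp: indirect_comparison_def indirect_margin_def)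
  then have off': "(x, z) \<in> offdiag A" "(z, x) \<in> offdiag A"
    using off by (auto simp: offdiag_def)
  let ?s = "indirect_score A v"
  have comp: "min (?s (a, b)) (?s (b, c)) \<le> ?s (a, c)"
    if "(a, b) \<in> offdiag A" "(b, c) \<in> offdiag A" "(a, c) \<in> offdiag A" for a b c
    using indirect_score_compose[OF that, of _ v] by simp
  have "?s (y, x) < ?s (x, y)" "?s (z, y) < ?s (y, z)"
    using xy yz by (simp_all add: indirect_comparison_def indirect_margin_def)
  \<comment> \<open>Suppose \<open>?s (x, z) \<le> ?s (z, x)\<close>. Then the smaller of
    \<open>?s (x, y)\<close> and \<open>?s (y, z)\<close> is at most \<open>?s (z, x)\<close>. If it
    is \<open>?s (x, y)\<close>, composing from \<open>y\<close> via \<open>z\<close> to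
    \<open>x\<close> gives \<open>?s (x, y) \<le> ?s (y, x)\<close>; if it is
    \<open>?s (y, z)\<close>, composing from \<open>z\<close> via \<open>x\<close> to
    \<open>y\<close> gives \<open>?s (y, z) \<le> ?s (z, y)\<close>. Both are excluded.\<close>
  then have "?s (z, x) < ?s (x, z)"
    using comp[of x y z] comp[of y z x] comp[of z x y] off off' by (auto simp: min_def split: if_splits)
  then show "(x, z) \<in> indirect_comparison A v"
    using off' by (simp add: indirect_comparison_def indirect_margin_def)
qed

text \<open>Options are ordered by their number of predecessors, with ties broken arbitrarily.\<close>

lemma ex_admissible_order: "\<exists>\<xi>. admissible_order A v \<xi>"
proof -
  define \<kappa> where "\<kappa> = indirect_comparison A v"
  obtain f :: "'a \<Rightarrow> nat" where f: "inj_on f A"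
    using finite_imp_inj_to_nat_seg[OF fin] by blast
  define d where "d x = card {p. (p, x) \<in> \<kappa>}" for x
  define \<xi> where "\<xi> = {(x, y) \<in> offdiag A. d x < d y \<or> d x = d y \<and> f x < f y}"
  have \<kappa>_sub: "\<kappa> \<subseteq> offdiag A" by (auto simp: \<kappa>_def indirect_comparison_def)
  have "d x < d y" if "(x, y) \<in> \<kappa>" for x y
    unfolding d_def
  proof (rule psubset_card_mono)
    have "{p. (p, y) \<in> \<kappa>} \<subseteq> A" using \<kappa>_sub by (auto simp: offdiag_def)
    then show "finite {p. (p, y) \<in> \<kappa>}" using fin finite_subset by blast
    have "(x, x) \<notin> \<kappa>" using \<kappa>_sub by (auto simp: offdiag_def)
    moreover have "(p, y) \<in> \<kappa>" if "(p, x) \<in> \<kappa>" for p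
      using trans_indirect_comparison that \<open>(x, y) \<in> \<kappa>\<close> unfolding \<kappa>_def by (blast dest: transD)
    ultimately show "{p. (p, x) \<in> \<kappa>} \<subset> {p. (p, y) \<in> \<kappa>}" using that by blast
  qed
  then have "\<kappa> \<subseteq> \<xi>" using \<kappa>_sub by (auto simp: \<xi>_def)
  moreover have "trans \<xi>"
    by (auto simp: \<xi>_def offdiag_def intro!: transI)
  moreover have "total_on A \<xi>"
    using f by (force simp: \<xi>_def offdiag_def total_on_def inj_on_def)
  ultimately have "admissible_order A v \<xi>"
    by (auto simp: admissible_order_def \<kappa>_def \<xi>_def)
  then show ?thesis ..
qed

end

section \<open>Transposing tied consecutive options\<close>

lemma indirect_margin_antisym: "indirect_margin A v (y, x) = - indirect_margin A v (x, y)"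
  by (simp add: indirect_margin_def)

text \<open>Applied where two index sets of projected scores differ only by the tied option, whose
  score is dominated by that of a neighbour.\<close>

lemma Max_insert_absorb:
  fixes c :: "'a :: linorder"
  assumes "finite S" and "s \<in> S" and "c \<le> s"
  shows "Max (insert c S) = Max S"
  using assms max_absorb2[OF order.trans[OF assms(3) Max_ge[OF assms(1,2)]]]
  by (subst Max_insert) auto

lemma Min_insert_absorb:
  fixes c :: "'a :: linorder"
  assumes "finite S" and "s \<in> S" and "s \<le> c"
  shows "Min (insert c S) = Min S"
  using assms min_absorb2[OF order.trans[OF Min_le[OF assms(1,2)] assms(3)]]
  by (subst Min_insert) auto

section \<open>Superdiagonal margins of a fixed order\<close>

context finite_linear_order
begin

lemma succ_neq: "x \<in> Domain \<xi> \<Longrightarrow> succ_in \<xi> x \<noteq> x"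
  using lessD[OF less_succ[of x]] by auto

lemma succ_inj:
  assumes "x \<in> Domain \<xi>" "y \<in> Domain \<xi>" "succ_in \<xi> x = succ_in \<xi> y"
  shows "x = y"
proof (rule ccontr)
  assume "x \<noteq> y"
  then have "(x, y) \<in> \<xi>" "(y, x) \<in> \<xi>"
    using less_succ_iff[OF assms(1), of y] less_succ_iff[OF assms(2), of x]
      less_succ[OF assms(1)] less_succ[OF assms(2)] assms(3) by auto
  then show False using asym by blast
qed

definition sigma_pairs :: "'a \<Rightarrow> ('a \<times> 'a) set" where
  "sigma_pairs x = {(p, q). (p, x) \<in> \<xi>\<^sup>= \<and> (succ_in \<xi> x, q) \<in> \<xi>\<^sup>=}"

lemma sigma_margin_eq: "sigma_margin A v \<xi> x = Min (indirect_margin A v ` sigma_pairs x)"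
  by (simp add: sigma_margin_def sigma_pairs_def)

lemma sigma_pairs_subset:
  assumes "x \<in> Domain \<xi>"
  shows "sigma_pairs x \<subseteq> \<xi>"
proof clarify
  fix p q assume "(p, q) \<in> sigma_pairs x"
  then have "(p, x) \<in> \<xi>\<^sup>=" and q: "(succ_in \<xi> x, q) \<in> \<xi>\<^sup>=" by (simp_all add: sigma_pairs_def)
  then have "(p, succ_in \<xi> x) \<in> \<xi>" using less_succ_iff[OF assms] by blast
  with q show "(p, q) \<in> \<xi>" using less_trans by blast
qed

lemma finite_sigma_pairs: "x \<in> Domain \<xi> \<Longrightarrow> finite (sigma_pairs x)"
  using sigma_pairs_subset finite_order finite_subset by blast

lemma succ_in_sigma_pairs: "(x, succ_in \<xi> x) \<in> sigma_pairs x"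
  by (simp add: sigma_pairs_def)

lemma sigma_margin_le:
  "x \<in> Domain \<xi> \<Longrightarrow> sigma_margin A v \<xi> x \<le> indirect_margin A v (x, succ_in \<xi> x)"
  unfolding sigma_margin_eq using finite_sigma_pairs succ_in_sigma_pairs by (intro Min_le) auto

text \<open>A negative margin would put the reversed pair into \<open>indirect_comparison\<close>,
  hence into \<open>\<xi>\<close>, against asymmetry.\<close>

lemma indirect_margin_nonneg:
  assumes "admissible_order A v \<xi>" and "(x, y) \<in> \<xi>"
  shows "0 \<le> indirect_margin A v (x, y)"
proof -
  have "(y, x) \<notin> indirect_comparison A v" "(y, x) \<in> offdiag A"
    using assms asym lessD unfolding admissible_order_def offdiag_def by blast+
  then show ?thesis
    by (simp add: indirect_comparison_def indirect_margin_antisym[of A v y])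
qed

lemma sigma_margin_nonneg:
  assumes "admissible_order A v \<xi>" and "x \<in> Domain \<xi>"
  shows "0 \<le> sigma_margin A v \<xi> x"
  unfolding sigma_margin_eq
proof (rule Min.boundedI)
  show "finite (indirect_margin A v ` sigma_pairs x)"
    using finite_sigma_pairs[OF assms(2)] by (rule finite_imageI)
  show "indirect_margin A v ` sigma_pairs x \<noteq> {}"
    using succ_in_sigma_pairs by blast
  show "0 \<le> m" if "m \<in> indirect_margin A v ` sigma_pairs x" for m
    using that sigma_pairs_subset[OF assms(2)] indirect_margin_nonneg[OF assms(1)] by auto
qed

end

section \<open>Effect of a transposition on margins and on the polytope of turnouts\<close>

locale adjacent_swap = finite_linear_order A \<xi> for A :: "'a set" and \<xi> +
  fixes v :: "'a \<times> 'a \<Rightarrow> real" and a :: 'a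
  assumes admissible: "admissible_order A v \<xi>"
    and not_last: "a \<in> Domain \<xi>"
    and tie: "indirect_margin A v (a, succ_in \<xi> a) = 0"
begin

abbreviation b :: 'a where "b \<equiv> succ_in \<xi> a"

abbreviation \<pi> :: "'a \<Rightarrow> 'a" where "\<pi> \<equiv> Transposition.transpose a b"

text \<open>As \<open>a\<close> and \<open>b\<close> are consecutive, this is \<open>\<xi>\<close>
  with the single pair \<open>(a, b)\<close> reversed. The form as a preimage under the involution
  \<open>\<pi>\<close> lets domain, successors and index sets be transported along
  \<open>\<pi>\<close>.\<close>

definition swapped :: "('a \<times> 'a) set" where
  "swapped = {(x, y). (\<pi> x, \<pi> y) \<in> \<xi>}"

lemma ab: "(a, b) \<in> \<xi>" "a \<in> A" "b \<in> A" "a \<noteq> b" "b \<noteq> a"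
  using less_succ[OF not_last] lessD[OF less_succ[OF not_last]] by auto

lemma in_swapped_iff: "(x, y) \<in> swapped \<longleftrightarrow> (\<pi> x, \<pi> y) \<in> \<xi>"
  by (simp add: swapped_def)

lemma less_b_iff: "(p, b) \<in> \<xi> \<longleftrightarrow> (p, a) \<in> \<xi> \<or> p = a"
  using less_succ_iff[OF not_last, of p] by simp

lemma a_less_iff: "(a, q) \<in> \<xi> \<longleftrightarrow> (b, q) \<in> \<xi> \<or> q = b"
  using succ_least[OF not_last, of q] ab less_trans by blast

lemma not_less_self: "(x, x) \<notin> \<xi>"
  using lessD(3) by blast

lemma swap_carrier: "\<pi> x \<in> A \<longleftrightarrow> x \<in> A"
  using ab by (auto simp: Transposition.transpose_def)

lemma swap_eq_iff: "\<pi> x = \<pi> y \<longleftrightarrow> x = y"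
  by (metis transpose_involutory)

text \<open>Nothing lies between \<open>a\<close> and \<open>b\<close>, so both compare alike with
  every other option; only their mutual comparison is affected.\<close>

lemma swap_less:
  assumes "(x, y) \<in> \<xi>" and "(x, y) \<noteq> (a, b)"
  shows "(\<pi> x, \<pi> y) \<in> \<xi>"
  using assms less_b_iff[of x] a_less_iff[of y] ab not_less_self[of x]
  by (cases "x = a"; cases "x = b"; cases "y = a"; cases "y = b")
    (simp_all add: less_b_iff[symmetric] a_less_iff)

lemma swapped_linear: "finite_linear_order A swapped"
proof
  show "finite A" by (rule finite_carrier)
  show "swapped \<subseteq> offdiag A"
  proof clarify
    fix x y assume "(x, y) \<in> swapped"
    then have "(\<pi> x, \<pi> y) \<in> \<xi>" by (simp add: in_swapped_iff)
    from lessD[OF this] show "(x, y) \<in> offdiag A"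
      by (simp add: swap_carrier swap_eq_iff offdiag_def)
  qed
  show "trans swapped"
    unfolding in_swapped_iff trans_def using less_trans by blast
  show "total_on A swapped"
    unfolding total_on_def in_swapped_iff using linear swap_carrier swap_eq_iff by metis
qed

sublocale swapped: finite_linear_order A swapped
  by (rule swapped_linear)

text \<open>The only pair that the transposition removes is \<open>(a, b)\<close>, and the tie keeps
  it out of \<open>indirect_comparison\<close>.\<close>

lemma admissible_swapped: "admissible_order A v swapped"
proof -
  have "(\<pi> x, \<pi> y) \<in> \<xi>" if "(x, y) \<in> indirect_comparison A v" for x y
  proof (rule swap_less)
    show "(x, y) \<in> \<xi>" using that admissible by (auto simp: admissible_order_def)
    show "(x, y) \<noteq> (a, b)" using that tie by (auto simp: indirect_comparison_def)
  qed
  then show ?thesis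
    using swapped.subset_offdiag swapped.trans_order swapped.total_order
    by (auto simp: admissible_order_def in_swapped_iff)
qed

lemma Domain_swapped: "Domain swapped = \<pi> ` Domain \<xi>"
proof
  show "Domain swapped \<subseteq> \<pi> ` Domain \<xi>"
  proof clarify
    fix x y assume "(x, y) \<in> swapped"
    then have "\<pi> x \<in> Domain \<xi>" by (auto simp: in_swapped_iff)
    then have "\<pi> (\<pi> x) \<in> \<pi> ` Domain \<xi>" by (rule imageI)
    then show "x \<in> \<pi> ` Domain \<xi>" by simp
  qed
  show "\<pi> ` Domain \<xi> \<subseteq> Domain swapped"
  proof clarify
    fix x y assume "(x, y) \<in> \<xi>"
    then have "(\<pi> x, \<pi> y) \<in> swapped" by (simp add: in_swapped_iff)
    then show "\<pi> x \<in> Domain swapped" by blast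
  qed
qed

lemma succ_swapped:
  assumes "x \<in> Domain \<xi>"
  shows "succ_in swapped (\<pi> x) = \<pi> (succ_in \<xi> x)"
proof (rule swapped.succ_in_eqI)
  show "(\<pi> x, \<pi> (succ_in \<xi> x)) \<in> swapped"
    using less_succ[OF assms] by (simp add: in_swapped_iff)
  fix z assume "(\<pi> x, z) \<in> swapped"
  then have "(succ_in \<xi> x, \<pi> z) \<in> \<xi>\<^sup>="
    using succ_least[OF assms] by (simp add: in_swapped_iff)
  then show "(\<pi> (succ_in \<xi> x), z) \<in> swapped\<^sup>="
    by (auto simp: in_swapped_iff)
qed

text \<open>The pair \<open>(a, b)\<close> with margin 0 takes part in the minimum, and
  admissibility makes all its members nonnegative.\<close>

lemma sigma_margin_a: "sigma_margin A v \<xi> a = 0"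
  using sigma_margin_le[OF not_last, of v] tie sigma_margin_nonneg[OF admissible not_last] by simp

lemma sigma_margin_swapped:
  assumes "x \<in> Domain \<xi>"
  shows "sigma_margin A v swapped (\<pi> x) = sigma_margin A v \<xi> x"
proof (cases "x = a")
  case True
  have dom: "\<pi> a \<in> Domain swapped" using not_last Domain_swapped by blast
  have "succ_in swapped (\<pi> a) = a" using succ_swapped[OF not_last] by simp
  then have "sigma_margin A v swapped (\<pi> a) = 0"
    using swapped.sigma_margin_le[OF dom, of v] tie indirect_margin_antisym[of A v b a]
      swapped.sigma_margin_nonneg[OF admissible_swapped dom] by simp
  then show ?thesis using True sigma_margin_a by simp
next
  case False
  let ?y = "succ_in \<xi> x"
  \<comment> \<open>For \<open>x\<close> other than \<open>a\<close>, the initial segment ending in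
    \<open>x\<close> contains both or neither of \<open>a\<close> and \<open>b\<close>, and so does
    the final segment starting in \<open>?y\<close>. Hence the transposition changes neither
    segment.\<close>
  have "?y \<noteq> b" using succ_inj[OF assms not_last] False by blast
  have lower: "(p, \<pi> x) \<in> swapped\<^sup>= \<longleftrightarrow> (p, x) \<in> \<xi>\<^sup>=" for p
    using False ab a_less_iff[of x] less_b_iff not_less_self
    by (auto simp: in_swapped_iff Transposition.transpose_def split: if_splits)
  have upper: "(\<pi> ?y, q) \<in> swapped\<^sup>= \<longleftrightarrow> (?y, q) \<in> \<xi>\<^sup>=" for q
    using \<open>?y \<noteq> b\<close> ab less_b_iff[of ?y] a_less_iff not_less_self
    by (auto simp: in_swapped_iff Transposition.transpose_def split: if_splits)
  have "swapped.sigma_pairs (\<pi> x) = sigma_pairs x"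
    unfolding swapped.sigma_pairs_def sigma_pairs_def succ_swapped[OF assms] lower upper ..
  then show ?thesis by (simp add: sigma_margin_eq swapped.sigma_margin_eq)
qed

lemma offdiag_swap_iff: "(\<pi> x, \<pi> y) \<in> offdiag A \<longleftrightarrow> (x, y) \<in> offdiag A"
  by (simp add: offdiag_def swap_carrier swap_eq_iff)

lemma ball_swap: "(\<forall>z\<in>A - {\<pi> x, \<pi> y}. P z) \<longleftrightarrow> (\<forall>z\<in>A - {x, y}. P (\<pi> z))"
proof -
  have "A - {\<pi> x, \<pi> y} = \<pi> ` A - \<pi> ` {x, y}"
    using ab by simp
  also have "\<dots> = \<pi> ` (A - {x, y})"
    by (rule image_set_diff[symmetric]) (auto simp: inj_def swap_eq_iff)
  finally show ?thesis by simp
qed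

lemma ball_offdiag_swap:
  "(\<forall>(x, y)\<in>offdiag A. P x y) \<longleftrightarrow> (\<forall>(x, y)\<in>offdiag A. P (\<pi> x) (\<pi> y))"
proof (intro iffI ballI; clarify)
  fix x y assume "\<forall>(x, y)\<in>offdiag A. P x y" "(x, y) \<in> offdiag A"
  then show "P (\<pi> x) (\<pi> y)"
    using offdiag_swap_iff[of x y] by blast
next
  fix x y assume *: "\<forall>(x, y)\<in>offdiag A. P (\<pi> x) (\<pi> y)" "(x, y) \<in> offdiag A"
  then have "(\<pi> x, \<pi> y) \<in> offdiag A"
    using offdiag_swap_iff by blast
  then have "P (\<pi> (\<pi> x)) (\<pi> (\<pi> y))"
    using *(1) by blast
  then show "P x y" by simp
qed

text \<open>Transport of structure: relabelling by \<open>\<pi>\<close> carries domain, successors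
  and superdiagonal margins over, so the groups of constraints correspond one by one.\<close>

lemma feasible_swapped_iff:
  "\<tau> \<in> sigma_feasible A v swapped \<longleftrightarrow> \<tau> \<circ> map_prod \<pi> \<pi> \<in> sigma_feasible A v \<xi>"
proof -
  have ext: "\<tau> \<in> offdiag A \<rightarrow>\<^sub>E UNIV \<longleftrightarrow> \<tau> \<circ> map_prod \<pi> \<pi> \<in> offdiag A \<rightarrow>\<^sub>E UNIV"
    unfolding PiE_iff extensional_def
    by (auto simp: offdiag_swap_iff) (metis offdiag_swap_iff transpose_involutory)
  have sym: "(\<forall>(x, y)\<in>offdiag A. \<tau> (x, y) = \<tau> (y, x)) \<longleftrightarrow>
      (\<forall>(x, y)\<in>offdiag A. (\<tau> \<circ> map_prod \<pi> \<pi>) (x, y) = (\<tau> \<circ> map_prod \<pi> \<pi>) (y, x))"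
    by (subst ball_offdiag_swap) simp
  have superdiag: "(\<forall>x\<in>Domain swapped. sigma_margin A v swapped x \<le> \<tau> (x, succ_in swapped x) \<and>
        \<tau> (x, succ_in swapped x) \<le> 1) \<longleftrightarrow>
      (\<forall>x\<in>Domain \<xi>. sigma_margin A v \<xi> x \<le> (\<tau> \<circ> map_prod \<pi> \<pi>) (x, succ_in \<xi> x) \<and>
        (\<tau> \<circ> map_prod \<pi> \<pi>) (x, succ_in \<xi> x) \<le> 1)"
    by (simp add: Domain_swapped succ_swapped sigma_margin_swapped)
  have rows: "(\<forall>x\<in>Domain swapped. \<forall>z\<in>A - {x, succ_in swapped x}.
        0 \<le> \<tau> (x, z) - \<tau> (succ_in swapped x, z) \<and>
        \<tau> (x, z) - \<tau> (succ_in swapped x, z) \<le> sigma_margin A v swapped x) \<longleftrightarrow>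
      (\<forall>x\<in>Domain \<xi>. \<forall>z\<in>A - {x, succ_in \<xi> x}.
        0 \<le> (\<tau> \<circ> map_prod \<pi> \<pi>) (x, z) - (\<tau> \<circ> map_prod \<pi> \<pi>) (succ_in \<xi> x, z) \<and>
        (\<tau> \<circ> map_prod \<pi> \<pi>) (x, z) - (\<tau> \<circ> map_prod \<pi> \<pi>) (succ_in \<xi> x, z)
          \<le> sigma_margin A v \<xi> x)"
    unfolding Domain_swapped ball_simps
    by (rule ball_cong[OF refl]) (simp only: succ_swapped sigma_margin_swapped ball_swap comp_apply map_prod_simp)
  show ?thesis
    by (simp only: sigma_feasible_def mem_Collect_eq ext sym superdiag rows)
qed

lemma feasibleD:
  assumes "\<tau> \<in> sigma_feasible A v \<xi>"
  shows "(x, y) \<in> offdiag A \<Longrightarrow> \<tau> (x, y) = \<tau> (y, x)"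
    and "x \<in> Domain \<xi> \<Longrightarrow> z \<in> A \<Longrightarrow> z \<noteq> x \<Longrightarrow> z \<noteq> succ_in \<xi> x \<Longrightarrow>
      \<tau> (succ_in \<xi> x, z) \<le> \<tau> (x, z)"
    and "x \<in> Domain \<xi> \<Longrightarrow> z \<in> A \<Longrightarrow> z \<noteq> x \<Longrightarrow> z \<noteq> succ_in \<xi> x \<Longrightarrow>
      \<tau> (x, z) \<le> \<tau> (succ_in \<xi> x, z) + sigma_margin A v \<xi> x"
proof -
  have "\<forall>(x, y)\<in>offdiag A. \<tau> (x, y) = \<tau> (y, x)"
    and rows: "\<forall>x\<in>Domain \<xi>. \<forall>z\<in>A - {x, succ_in \<xi> x}.
      0 \<le> \<tau> (x, z) - \<tau> (succ_in \<xi> x, z) \<and>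
      \<tau> (x, z) - \<tau> (succ_in \<xi> x, z) \<le> sigma_margin A v \<xi> x"
    using assms unfolding sigma_feasible_def mem_Collect_eq by - (elim conjE; assumption)+
  then show "(x, y) \<in> offdiag A \<Longrightarrow> \<tau> (x, y) = \<tau> (y, x)" by auto
  assume "x \<in> Domain \<xi>" "z \<in> A" "z \<noteq> x" "z \<noteq> succ_in \<xi> x"
  then have "0 \<le> \<tau> (x, z) - \<tau> (succ_in \<xi> x, z) \<and>
      \<tau> (x, z) - \<tau> (succ_in \<xi> x, z) \<le> sigma_margin A v \<xi> x"
    by (intro rows[rule_format]) auto
  then show "\<tau> (succ_in \<xi> x, z) \<le> \<tau> (x, z)"
    "\<tau> (x, z) \<le> \<tau> (succ_in \<xi> x, z) + sigma_margin A v \<xi> x" by simp_all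
qed

lemma feasible_tie:
  assumes "\<tau> \<in> sigma_feasible A v \<xi>" "z \<in> A" "z \<noteq> a" "z \<noteq> b"
  shows "\<tau> (b, z) = \<tau> (a, z)"
  using feasibleD(2,3)[OF assms(1) not_last assms(2-4)] sigma_margin_a by simp

text \<open>Rows \<open>a\<close> and \<open>b\<close> agree by \<open>feasible_tie\<close>, columns
  then by symmetry, and symmetry also equates the entries \<open>(a, b)\<close> and
  \<open>(b, a)\<close>. Off \<open>offdiag A\<close>, which \<open>\<pi>\<close> preserves, both
  sides are \<open>undefined\<close>.\<close>

lemma feasible_swap_invariant:
  assumes "\<tau> \<in> sigma_feasible A v \<xi>"
  shows "\<tau> \<circ> map_prod \<pi> \<pi> = \<tau>"
proof
  fix e :: "'a \<times> 'a"
  obtain x y where e: "e = (x, y)" by fastforce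
  show "(\<tau> \<circ> map_prod \<pi> \<pi>) e = \<tau> e"
  proof (cases "(x, y) \<in> offdiag A")
    case False
    then show ?thesis
      using assms offdiag_swap_iff[of x y]
      by (auto simp: e sigma_feasible_def PiE_iff extensional_def)
  next
    case True
    have sym: "\<tau> (p, q) = \<tau> (q, p)" if "p \<in> A" "q \<in> A" "p \<noteq> q" for p q
      using feasibleD(1)[OF assms] that by (simp add: offdiag_def)
    have xy: "x \<in> A" "y \<in> A" "x \<noteq> y" using True by (simp_all add: offdiag_def)
    show ?thesis
      using xy ab feasible_tie[OF assms, of x] feasible_tie[OF assms, of y]
        sym[of a b] sym[of x a] sym[of x b]
      by (cases "x = a"; cases "x = b"; cases "y = a"; cases "y = b") (simp_all add: e)
  qed
qed

text \<open>Relabelling maps one polytope onto the other and fixes each point of the one belonging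
  to \<open>\<xi>\<close>; so the two are equal as sets. The objective does not involve the order,
  hence the minimizers coincide too.\<close>

lemma sigma_feasible_swapped: "sigma_feasible A v swapped = sigma_feasible A v \<xi>"
proof -
  have inv: "\<tau> \<circ> map_prod \<pi> \<pi> \<circ> map_prod \<pi> \<pi> = \<tau>" for \<tau> :: "'a \<times> 'a \<Rightarrow> real"
    by (auto simp: fun_eq_iff)
  show ?thesis
  proof (intro set_eqI iffI)
    fix \<tau> assume "\<tau> \<in> sigma_feasible A v swapped"
    then have *: "\<tau> \<circ> map_prod \<pi> \<pi> \<in> sigma_feasible A v \<xi>" by (simp only: feasible_swapped_iff)
    from feasible_swap_invariant[OF *] have "\<tau> = \<tau> \<circ> map_prod \<pi> \<pi>" by (simp only: inv)
    with * show "\<tau> \<in> sigma_feasible A v \<xi>" by simp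
  next
    fix \<tau> assume "\<tau> \<in> sigma_feasible A v \<xi>"
    then show "\<tau> \<in> sigma_feasible A v swapped"
      by (simp only: feasible_swapped_iff feasible_swap_invariant)
  qed
qed

lemma sigma_turnout_swapped: "sigma_turnout A v swapped = sigma_turnout A v \<xi>"
  by (simp add: sigma_turnout_def sigma_feasible_swapped)

end

section \<open>Effect of a transposition on the projected scores\<close>

context finite_linear_order
begin

definition steps :: "'a \<Rightarrow> 'a \<Rightarrow> 'a set" where
  "steps x y = {p. (x, p) \<in> \<xi>\<^sup>= \<and> (p, y) \<in> \<xi>}"

lemma steps_subset: "steps x y \<subseteq> Domain \<xi>"
  by (auto simp: steps_def)

lemma finite_steps: "finite (steps x y)"
  using finite_subset[OF steps_subset] finite_order by (simp add: finite_Domain)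

lemma first_in_steps: "(x, y) \<in> \<xi> \<Longrightarrow> x \<in> steps x y"
  by (simp add: steps_def)

lemma projected_score_eq:
  "projected_score A v \<xi> (x, y) =
    (if (x, y) \<in> \<xi> then Max (forward_score A v \<xi> ` steps x y)
     else Min (backward_score A v \<xi> ` steps y x))"
  by (simp add: projected_score_def steps_def)

end

context adjacent_swap
begin

lemma steps_swapped: "swapped.steps x y = \<pi> ` steps (\<pi> x) (\<pi> y)"
proof -
  have iff: "p \<in> swapped.steps x y \<longleftrightarrow> \<pi> p \<in> steps (\<pi> x) (\<pi> y)" for p
    by (simp add: swapped.steps_def steps_def in_swapped_iff swap_eq_iff)
  show ?thesis
  proof (intro set_eqI iffI)
    fix p assume "p \<in> swapped.steps x y"
    then have "\<pi> (\<pi> p) \<in> \<pi> ` steps (\<pi> x) (\<pi> y)" unfolding iff by (rule imageI)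
    then show "p \<in> \<pi> ` steps (\<pi> x) (\<pi> y)" by simp
  qed (auto simp: iff)
qed

lemma
  shows steps_a_b: "steps a b = {a}"
    and steps_from_a: "(b, y) \<in> \<xi> \<Longrightarrow> steps a y = insert a (steps b y)"
    and steps_to_b: "(x, a) \<in> \<xi> \<Longrightarrow> steps x b = insert a (steps x a)"
  using a_less_iff less_b_iff asym ab by (auto simp: steps_def)

end

text \<open>\<open>sigma_turnout\<close> is a definite description, so its feasibility rests on
  existence and uniqueness of the minimizer. It is assumed here and supplied later by
  \<open>sigma_turnout_feasible\<close>.\<close>

locale feasible_adjacent_swap = adjacent_swap +
  assumes feasible: "sigma_turnout A v \<xi> \<in> sigma_feasible A v \<xi>"
begin

abbreviation t :: "'a \<times> 'a \<Rightarrow> real" where "t \<equiv> sigma_turnout A v \<xi>"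

abbreviation f :: "'a \<Rightarrow> real" where "f \<equiv> forward_score A v \<xi>"

abbreviation g :: "'a \<Rightarrow> real" where "g \<equiv> backward_score A v \<xi>"

lemma turnout_swap: "t (\<pi> x, \<pi> y) = t (x, y)"
  using fun_cong[OF feasible_swap_invariant[OF feasible], of "(x, y)"] by simp

lemma turnout_sym: "x \<in> A \<Longrightarrow> y \<in> A \<Longrightarrow> x \<noteq> y \<Longrightarrow> t (x, y) = t (y, x)"
  using feasibleD(1)[OF feasible] by (simp add: offdiag_def)

lemma
  assumes "x \<in> Domain \<xi>"
  shows forward_score_swapped: "forward_score A v swapped (\<pi> x) = f x"
    and backward_score_swapped: "backward_score A v swapped (\<pi> x) = g x"
  by (simp_all add: forward_score_def backward_score_def sigma_turnout_swapped
      succ_swapped[OF assms] sigma_margin_swapped[OF assms] turnout_swap)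

lemma score_a: "f a = t (a, b) / 2" "g a = t (a, b) / 2"
  by (simp_all add: forward_score_def backward_score_def sigma_margin_a)

text \<open>The row constraint between \<open>b\<close> and its successor \<open>?c\<close>, read in
  column \<open>a\<close>, places \<open>t (a, b)\<close> between \<open>t (b, ?c)\<close> and
  \<open>t (b, ?c) + sigma_margin A v \<xi> b\<close>, since the tied rows give
  \<open>t (?c, a) = t (b, ?c)\<close>. Both scores of the tied step are half of
  \<open>t (a, b)\<close>.\<close>

lemma scores_after_tie:
  assumes "b \<in> Domain \<xi>"
  shows "f a \<le> f b" "g b \<le> g a"
proof -
  let ?c = "succ_in \<xi> b"
  have "(a, ?c) \<in> \<xi>" using ab(1) less_succ[OF assms] by (rule less_trans)
  then have c: "?c \<in> A" "?c \<noteq> a" "?c \<noteq> b" using lessD[of a ?c] succ_neq[OF assms] by auto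
  have "t (?c, a) \<le> t (b, a)" "t (b, a) \<le> t (?c, a) + sigma_margin A v \<xi> b"
    using feasibleD(2,3)[OF feasible assms, of a] c ab by auto
  moreover have "t (?c, a) = t (b, ?c)"
    using feasible_tie[OF feasible c] turnout_sym[of ?c a] c ab by simp
  ultimately show "f a \<le> f b" "g b \<le> g a"
    using turnout_sym[of a b] ab unfolding score_a by (simp_all add: forward_score_def backward_score_def)
qed

text \<open>Mirror image of the previous argument: the row constraint between \<open>h\<close> and
  \<open>a\<close>, read in column \<open>b\<close>, with
  \<open>t (h, b) = t (h, a)\<close>.\<close>

lemma scores_before_tie:
  assumes "h \<in> Domain \<xi>" "succ_in \<xi> h = a"
  shows "f a \<le> f h" "g h \<le> g a"
proof -
  have "(h, b) \<in> \<xi>" using less_succ[OF assms(1)] assms(2) less_b_iff by auto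
  then have h: "h \<in> A" "h \<noteq> a" "h \<noteq> b" using lessD[of h b] succ_neq[OF assms(1)] assms(2) by auto
  have "t (a, b) \<le> t (h, b)" "t (h, b) \<le> t (a, b) + sigma_margin A v \<xi> h"
    using feasibleD(2,3)[OF feasible assms(1), of b] h ab assms(2) by auto
  moreover have "t (h, b) = t (h, a)"
    using feasible_tie[OF feasible h] turnout_sym[of h a] turnout_sym[of h b] h ab by simp
  ultimately show "f a \<le> f h" "g h \<le> g a"
    unfolding score_a by (simp_all add: forward_score_def backward_score_def assms(2))
qed

lemma projected_score_swapped:
  assumes "(x, y) \<in> offdiag A"
  shows "projected_score A v swapped (x, y) = projected_score A v \<xi> (\<pi> x, \<pi> y)"
proof -
  have "forward_score A v swapped ` swapped.steps x' y' = f ` steps (\<pi> x') (\<pi> y')" for x' y'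
    unfolding steps_swapped image_image
    using steps_subset by (intro image_cong refl forward_score_swapped) blast
  moreover have "backward_score A v swapped ` swapped.steps x' y' = g ` steps (\<pi> x') (\<pi> y')" for x' y'
    unfolding steps_swapped image_image
    using steps_subset by (intro image_cong refl backward_score_swapped) blast
  ultimately show ?thesis
    by (simp add: projected_score_eq swapped.projected_score_eq in_swapped_iff)
qed

text \<open>Starting from \<open>a\<close> instead of \<open>b\<close> adds only the step at
  \<open>a\<close>, and the step at \<open>b\<close> dominates it in the maximum as well as in the
  minimum.\<close>

lemma projected_score_after_tie:
  assumes "(b, y) \<in> \<xi>"
  shows "projected_score A v \<xi> (a, y) = projected_score A v \<xi> (b, y)"
    and "projected_score A v \<xi> (y, a) = projected_score A v \<xi> (y, b)"
proof -
  have b: "b \<in> Domain \<xi>" and ay: "(a, y) \<in> \<xi>"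
    using assms a_less_iff by auto
  have "Max (insert (f a) (f ` steps b y)) = Max (f ` steps b y)"
    using finite_steps first_in_steps[OF assms] scores_after_tie(1)[OF b]
    by (intro Max_insert_absorb) auto
  moreover have "Min (insert (g a) (g ` steps b y)) = Min (g ` steps b y)"
    using finite_steps first_in_steps[OF assms] scores_after_tie(2)[OF b]
    by (intro Min_insert_absorb) auto
  ultimately show "projected_score A v \<xi> (a, y) = projected_score A v \<xi> (b, y)"
    "projected_score A v \<xi> (y, a) = projected_score A v \<xi> (y, b)"
    using assms ay asym by (simp_all add: projected_score_eq steps_from_a)
qed

lemma projected_score_before_tie:
  assumes "(x, a) \<in> \<xi>"
  shows "projected_score A v \<xi> (x, b) = projected_score A v \<xi> (x, a)"
    and "projected_score A v \<xi> (b, x) = projected_score A v \<xi> (a, x)"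
proof -
  have xb: "(x, b) \<in> \<xi>" using assms less_b_iff by simp
  \<comment> \<open>The step from \<open>h\<close> into \<open>a\<close> belongs to
    \<open>steps x a\<close> and dominates the tied step that is added for \<open>b\<close>.\<close>
  obtain h where h: "(x, h) \<in> \<xi>\<^sup>=" "(h, a) \<in> \<xi>" "succ_in \<xi> h = a"
    using assms by (rule ex_pred)
  then have dom: "h \<in> Domain \<xi>" and h_step: "h \<in> steps x a" by (auto simp: steps_def)
  have "Max (insert (f a) (f ` steps x a)) = Max (f ` steps x a)"
    using finite_steps h_step scores_before_tie(1)[OF dom h(3)]
    by (intro Max_insert_absorb) auto
  moreover have "Min (insert (g a) (g ` steps x a)) = Min (g ` steps x a)"
    using finite_steps h_step scores_before_tie(2)[OF dom h(3)]
    by (intro Min_insert_absorb) auto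
  ultimately show "projected_score A v \<xi> (x, b) = projected_score A v \<xi> (x, a)"
    "projected_score A v \<xi> (b, x) = projected_score A v \<xi> (a, x)"
    using assms xb asym by (simp_all add: projected_score_eq steps_to_b)
qed

lemma projected_score_tie: "projected_score A v \<xi> (b, a) = projected_score A v \<xi> (a, b)"
  using ab asym by (simp add: projected_score_eq steps_a_b score_a)

lemma projected_score_tie_swap:
  assumes "z \<in> A" "z \<noteq> a" "z \<noteq> b"
  shows "projected_score A v \<xi> (b, z) = projected_score A v \<xi> (a, z)"
    and "projected_score A v \<xi> (z, b) = projected_score A v \<xi> (z, a)"
proof -
  have "(b, z) \<in> \<xi> \<or> (z, a) \<in> \<xi>"
    using linear[of b z] less_b_iff[of z] assms ab by auto
  then show "projected_score A v \<xi> (b, z) = projected_score A v \<xi> (a, z)"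
    "projected_score A v \<xi> (z, b) = projected_score A v \<xi> (z, a)"
    using projected_score_after_tie projected_score_before_tie by auto
qed

lemma projected_score_swap_invariant:
  assumes "(x, y) \<in> offdiag A"
  shows "projected_score A v \<xi> (\<pi> x, \<pi> y) = projected_score A v \<xi> (x, y)"
proof -
  have "x \<in> A" "y \<in> A" "x \<noteq> y" using assms by (auto simp: offdiag_def)
  then show ?thesis
    using projected_score_tie_swap[of x] projected_score_tie_swap[of y] projected_score_tie ab
    by (cases "x = a"; cases "x = b"; cases "y = a"; cases "y = b") simp_all
qed

lemma rate_wrt_swapped:
  assumes "x \<in> A"
  shows "rate_wrt A v swapped x = rate_wrt A v \<xi> x"
proof -
  have "projected_score A v swapped (x, y) = projected_score A v \<xi> (x, y)" if "y \<in> A - {x}" for y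
  proof -
    have "(x, y) \<in> offdiag A" using assms that by (auto simp: offdiag_def)
    then show ?thesis by (simp only: projected_score_swapped projected_score_swap_invariant)
  qed
  then show ?thesis by (simp add: rate_wrt_def)
qed

end

text \<open>Bubble sort: as long as \<open>\<xi>\<close> differs from \<open>\<eta>\<close>, a
  consecutive pair on which they disagree is transposed. This preserves admissibility and the rate
  and lowers the number of disagreements.\<close>

lemma rate_wrt_admissible_unique:
  assumes "finite A" and "x \<in> A"
    and feasible: "\<And>\<xi>. admissible_order A v \<xi> \<Longrightarrow> sigma_turnout A v \<xi> \<in> sigma_feasible A v \<xi>"
    and "admissible_order A v \<xi>" and \<eta>: "admissible_order A v \<eta>"
  shows "rate_wrt A v \<xi> x = rate_wrt A v \<eta> x"
  using assms(4)
proof (induction "card (\<xi> - \<eta>)" arbitrary: \<xi> rule: less_induct)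
  case less
  interpret \<xi>: finite_linear_order A \<xi>
    using assms(1) less.prems by (rule admissible_imp_linear)
  interpret \<eta>: finite_linear_order A \<eta>
    using assms(1) \<eta> by (rule admissible_imp_linear)
  show ?case
  proof (cases "\<xi> \<subseteq> \<eta>")
    case True
    then show ?thesis using \<xi>.subset_eq[OF \<eta>.finite_linear_order_axioms] by simp
  next
    case False
    then obtain a where a: "a \<in> Domain \<xi>" "(a, succ_in \<xi> a) \<notin> \<eta>"
      using \<xi>.subset_if_succ_subset[OF \<eta>.trans_order] by blast
    let ?b = "succ_in \<xi> a"
    have ab: "(a, ?b) \<in> \<xi>" using \<xi>.less_succ a(1) .
    then have ba: "(?b, a) \<in> \<eta>"
      using \<eta>.linear[OF \<xi>.lessD[OF ab]] a(2) by blast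
    \<comment> \<open>The pair is ordered in opposite ways by two admissible orders, so its margin
      is nonnegative in both directions.\<close>
    have "indirect_margin A v (a, ?b) = 0"
      using \<xi>.indirect_margin_nonneg[OF less.prems ab] \<eta>.indirect_margin_nonneg[OF \<eta> ba]
        indirect_margin_antisym[of A v ?b a] by simp
    then interpret feasible_adjacent_swap A \<xi> v a
      using less.prems a(1) feasible[OF less.prems] by unfold_locales
    \<comment> \<open>The transposition adds only \<open>(?b, a)\<close>, which lies in
      \<open>\<eta>\<close>, and removes \<open>(a, ?b)\<close>, which does not.\<close>
    have "(x, y) \<in> \<xi> - {(a, ?b)}" if "(x, y) \<in> swapped - \<eta>" for x y
    proof -
      have xy: "(\<pi> x, \<pi> y) \<in> \<xi>" using that by (simp add: in_swapped_iff)
      moreover have "(\<pi> x, \<pi> y) \<noteq> (a, ?b)"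
      proof
        assume "(\<pi> x, \<pi> y) = (a, ?b)"
        then have "\<pi> (\<pi> x) = \<pi> a" "\<pi> (\<pi> y) = \<pi> ?b" by simp_all
        then show False using that ba by simp
      qed
      ultimately have "(\<pi> (\<pi> x), \<pi> (\<pi> y)) \<in> \<xi>" by (rule swap_less)
      moreover have "(a, ?b) \<notin> swapped"
        using \<xi>.asym[OF ab(1)] by (simp add: in_swapped_iff)
      ultimately show ?thesis using that by auto
    qed
    then have "swapped - \<eta> \<subset> \<xi> - \<eta>" using ab(1) a(2) by auto
    then have "card (swapped - \<eta>) < card (\<xi> - \<eta>)"
      using \<xi>.finite_order by (intro psubset_card_mono) auto
    then have "rate_wrt A v swapped x = rate_wrt A v \<eta> x"
      using admissible_swapped by (rule less.hyps)
    then show ?thesis using rate_wrt_swapped[OF assms(2)] by simp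
  qed
qed

section \<open>The projection of the turnouts\<close>

text \<open>If \<open>f\<close> stays away from a neighbourhood of \<open>l\<close> along a finer
  filter, compactness of \<open>K\<close> gives a cluster point, and a further refinement makes
  \<open>f\<close> converge to it. Filters take the place of subsequences.\<close>

lemma tendsto_if_cluster_points_eq:
  fixes f :: "'b \<Rightarrow> 'c::topological_space"
  assumes "compact K" and "\<forall>\<^sub>F \<alpha> in F. f \<alpha> \<in> K"
    and unique: "\<And>G k. G \<noteq> bot \<Longrightarrow> G \<le> F \<Longrightarrow> (f \<longlongrightarrow> k) G \<Longrightarrow> k = l"
  shows "(f \<longlongrightarrow> l) F"
proof (rule topological_tendstoI, rule ccontr)
  fix S assume S: "open S" "l \<in> S" and "\<not> (\<forall>\<^sub>F \<alpha> in F. f \<alpha> \<in> S)"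
  define H where "H = inf F (principal {\<alpha>. f \<alpha> \<notin> S})"
  have "H \<noteq> bot"
    using \<open>\<not> (\<forall>\<^sub>F \<alpha> in F. f \<alpha> \<in> S)\<close>
    by (simp add: H_def trivial_limit_def eventually_inf_principal)
  have "H \<le> F" by (simp add: H_def)
  have "filtermap f H \<noteq> bot" using \<open>H \<noteq> bot\<close> by (simp add: filtermap_bot_iff)
  moreover have "eventually (\<lambda>k. k \<in> K) (filtermap f H)"
    using assms(2) \<open>H \<le> F\<close> by (simp add: eventually_filtermap filter_leD)
  ultimately obtain k where k: "inf (nhds k) (filtermap f H) \<noteq> bot"
    using assms(1) unfolding compact_filter by blast
  \<comment> \<open>\<open>G\<close> refines \<open>H\<close> just enough to force convergence to
    \<open>k\<close>; it is nontrivial because \<open>k\<close> is a cluster point of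
    \<open>filtermap f H\<close>.\<close>
  define G where "G = inf (filtercomap f (nhds k)) H"
  have "G \<noteq> bot"
  proof
    assume "G = bot"
    then have "eventually (\<lambda>_. False) G" by simp
    then obtain P Q where P: "eventually P (filtercomap f (nhds k))" and Q: "eventually Q H"
      and PQ: "\<And>\<alpha>. P \<alpha> \<and> Q \<alpha> \<Longrightarrow> False"
      unfolding G_def eventually_inf by blast
    obtain R where R: "eventually R (nhds k)" and RP: "\<And>\<alpha>. R (f \<alpha>) \<Longrightarrow> P \<alpha>"
      using P unfolding eventually_filtercomap by blast
    have "eventually (\<lambda>y. \<not> R y) (filtermap f H)"
      unfolding eventually_filtermap using Q by (rule eventually_mono) (use PQ RP in blast)
    then have "eventually (\<lambda>_. False) (inf (nhds k) (filtermap f H))"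
      using R unfolding eventually_inf by blast
    with k show False by (simp add: trivial_limit_def)
  qed
  moreover have "G \<le> F" using \<open>H \<le> F\<close> by (simp add: G_def le_infI2)
  moreover have "(f \<longlongrightarrow> k) G"
    unfolding filterlim_def G_def by (metis filtermap_filtercomap filtermap_mono inf_le1 order_trans)
  ultimately have "k = l" and lim: "(f \<longlongrightarrow> k) G" using unique by blast+
  \<comment> \<open>Along \<open>G\<close> the values enter \<open>S\<close>, a neighbourhood of
    their limit, whereas \<open>H\<close> keeps them outside.\<close>
  have "\<forall>\<^sub>F \<alpha> in G. f \<alpha> \<in> S"
    using topological_tendstoD[OF lim S(1)] S(2) \<open>k = l\<close> by simp
  moreover have "\<forall>\<^sub>F \<alpha> in G. f \<alpha> \<notin> S"
    unfolding G_def H_def by (simp add: eventually_inf_principal inf_assoc[symmetric])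
  ultimately have "\<forall>\<^sub>F \<alpha> in G. False" by eventually_elim simp
  with \<open>G \<noteq> bot\<close> show False by simp
qed

text \<open>Tychonoff's theorem, carried over to the topology of the function type.\<close>

lemma compact_PiE_fun:
  fixes K :: "'b \<Rightarrow> 'c::topological_space set"
  assumes "\<And>i. compact (K i)"
  shows "compact (PiE UNIV K)"
proof -
  have "compactin (product_topology (\<lambda>i. euclidean) UNIV) (PiE UNIV K)"
    using assms by (simp add: compactin_PiE)
  then show ?thesis by (simp add: euclidean_product_topology)
qed

lemma tendsto_fun_coordinate:
  fixes f :: "'b \<Rightarrow> 'i \<Rightarrow> 'c::topological_space"
  assumes "(f \<longlongrightarrow> k) F"
  shows "((\<lambda>\<alpha>. f \<alpha> i) \<longlongrightarrow> k i) F"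
proof (rule topological_tendstoI)
  fix S :: "'c set" assume "open S" "k i \<in> S"
  then have "open ((\<lambda>h. h i) -` S)" "k \<in> (\<lambda>h. h i) -` S"
    using open_vimage[OF _ continuous_on_product_coordinates] by auto
  then have "\<forall>\<^sub>F \<alpha> in F. f \<alpha> \<in> (\<lambda>h. h i) -` S"
    using topological_tendstoD[OF assms] by blast
  then show "\<forall>\<^sub>F \<alpha> in F. f \<alpha> i \<in> S" by simp
qed

section \<open>Squared distances and compact boxes\<close>

definition sqdist :: "'a set \<Rightarrow> ('a \<times> 'a \<Rightarrow> real) \<Rightarrow> ('a \<times> 'a \<Rightarrow> real) \<Rightarrow> real" where
  "sqdist A t \<tau> = (\<Sum>e\<in>offdiag A. (\<tau> e - t e)\<^sup>2)"

lemma sqdist_eq: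
  assumes "finite A"
  shows "(\<Sum>x\<in>A. \<Sum>y\<in>A - {x}. (\<tau> (x, y) - t (x, y))\<^sup>2) = sqdist A t \<tau>"
proof -
  have "(SIGMA x:A. A - {x}) = offdiag A" by (auto simp: offdiag_def)
  then show ?thesis
    using assms by (simp add: sum.Sigma sqdist_def case_prod_beta')
qed

lemma tendsto_sqdist:
  assumes "\<And>e. e \<in> offdiag A \<Longrightarrow> ((\<lambda>\<alpha>. t \<alpha> e) \<longlongrightarrow> t' e) F"
    and "\<And>e. e \<in> offdiag A \<Longrightarrow> ((\<lambda>\<alpha>. \<tau> \<alpha> e) \<longlongrightarrow> \<tau>' e) F"
  shows "((\<lambda>\<alpha>. sqdist A (t \<alpha>) (\<tau> \<alpha>)) \<longlongrightarrow> sqdist A t' \<tau>') F"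
  unfolding sqdist_def using assms by (intro tendsto_intros)

text \<open>A crude consequence of \<open>2 * d \<le> d\<^sup>2 + 1\<close>; it serves only to bound
  the minimizers.\<close>

lemma abs_diff_le_if_sqdist_le:
  assumes "finite A" and "sqdist A t \<tau> \<le> c" and "e \<in> offdiag A"
  shows "\<bar>\<tau> e - t e\<bar> \<le> 1 + c"
proof -
  define d where "d = \<bar>\<tau> e - t e\<bar>"
  have "d\<^sup>2 \<le> sqdist A t \<tau>"
    unfolding sqdist_def d_def power2_abs
    using assms(3) finite_offdiag[OF assms(1)] by (intro member_le_sum) auto
  then have "d\<^sup>2 \<le> c" using assms(2) by simp
  moreover have "0 \<le> (d - 1)\<^sup>2" by simp
  then have "2 * d \<le> d\<^sup>2 + 1" by (simp add: power2_diff)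
  moreover have "0 \<le> d\<^sup>2" by simp
  ultimately have "d \<le> 1 + c" by linarith
  then show ?thesis by (simp add: d_def)
qed

text \<open>The product runs over all pairs of the type, so the coordinates off
  \<open>offdiag A\<close> are confined to the default value: every factor is then compact, and the
  members are extensional.\<close>

definition offdiag_box :: "'a set \<Rightarrow> ('a \<times> 'a \<Rightarrow> real) \<Rightarrow> real \<Rightarrow> ('a \<times> 'a \<Rightarrow> real) set" where
  "offdiag_box A t r = PiE UNIV (\<lambda>e. if e \<in> offdiag A then cball (t e) r else {undefined})"

lemma compact_offdiag_box: "compact (offdiag_box A t r)"
  unfolding offdiag_box_def by (rule compact_PiE_fun) simp

lemma in_offdiag_box_iff:
  "\<tau> \<in> offdiag_box A t r \<longleftrightarrow> \<tau> \<in> offdiag A \<rightarrow>\<^sub>E UNIV \<and> (\<forall>e\<in>offdiag A. \<bar>\<tau> e - t e\<bar> \<le> r)"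
  by (auto simp: offdiag_box_def PiE_iff extensional_def dist_real_def abs_minus_commute)

section \<open>The polytope of turnouts with the margins as parameters\<close>

context finite_linear_order
begin

text \<open>The margins become a free argument \<open>m\<close>, so that the polytope can be varied
  and compared for different margins; the row constraints are rearranged into plain
  inequalities.\<close>

definition feasible_set :: "('a \<Rightarrow> real) \<Rightarrow> ('a \<times> 'a \<Rightarrow> real) set" where
  "feasible_set m = {\<tau> \<in> offdiag A \<rightarrow>\<^sub>E UNIV.
     (\<forall>x\<in>A. \<forall>y\<in>A. x \<noteq> y \<longrightarrow> \<tau> (x, y) = \<tau> (y, x)) \<and>
     (\<forall>x\<in>Domain \<xi>. m x \<le> \<tau> (x, succ_in \<xi> x) \<and> \<tau> (x, succ_in \<xi> x) \<le> 1) \<and>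
     (\<forall>x\<in>Domain \<xi>. \<forall>z\<in>A. z \<noteq> x \<longrightarrow> z \<noteq> succ_in \<xi> x \<longrightarrow>
       \<tau> (succ_in \<xi> x, z) \<le> \<tau> (x, z) \<and> \<tau> (x, z) \<le> \<tau> (succ_in \<xi> x, z) + m x)}"

lemma sigma_feasible_eq: "sigma_feasible A v \<xi> = feasible_set (sigma_margin A v \<xi>)"
proof -
  have sym: "(\<forall>(x, y)\<in>offdiag A. \<tau> (x, y) = \<tau> (y, x)) \<longleftrightarrow>
      (\<forall>x\<in>A. \<forall>y\<in>A. x \<noteq> y \<longrightarrow> \<tau> (x, y) = \<tau> (y, x))" for \<tau> :: "'a \<times> 'a \<Rightarrow> real"
    by (auto simp: offdiag_def)
  have rows: "(\<forall>z\<in>A - {x, y}. 0 \<le> \<tau> (x, z) - \<tau> (y, z) \<and> \<tau> (x, z) - \<tau> (y, z) \<le> c) \<longleftrightarrow>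
      (\<forall>z\<in>A. z \<noteq> x \<longrightarrow> z \<noteq> y \<longrightarrow> \<tau> (y, z) \<le> \<tau> (x, z) \<and> \<tau> (x, z) \<le> \<tau> (y, z) + c)"
    for \<tau> :: "'a \<times> 'a \<Rightarrow> real" and x y c
    by (auto simp: diff_le_eq add.commute)
  show ?thesis unfolding sigma_feasible_def feasible_set_def sym rows ..
qed

text \<open>Closedness jointly in the point and the margins: each constraint is a weak inequality
  between converging quantities, or a pair of them for an equation.\<close>

lemma feasible_limit:
  assumes "G \<noteq> bot" and lim: "(\<tau> \<longlongrightarrow> \<tau>') G"
    and m: "\<And>x. x \<in> Domain \<xi> \<Longrightarrow> ((\<lambda>\<alpha>. m \<alpha> x) \<longlongrightarrow> m' x) G"
    and ev: "\<forall>\<^sub>F \<alpha> in G. \<tau> \<alpha> \<in> feasible_set (m \<alpha>)"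
  shows "\<tau>' \<in> feasible_set m'"
proof -
  note coord = tendsto_fun_coordinate[OF lim]
  have le: "c' \<le> d'"
    if "(c \<longlongrightarrow> c') G" "(d \<longlongrightarrow> d') G" "\<And>\<alpha>. \<tau> \<alpha> \<in> feasible_set (m \<alpha>) \<Longrightarrow> c \<alpha> \<le> d \<alpha>"
    for c d :: "_ \<Rightarrow> real" and c' d'
    using assms(1) that(2,1) eventually_mono[OF ev that(3)] by (rule tendsto_le)
  have "\<tau>' \<in> offdiag A \<rightarrow>\<^sub>E UNIV"
  proof (rule PiE_I)
    fix e assume e: "e \<notin> offdiag A"
    obtain x y where "e = (x, y)" by fastforce
    show "\<tau>' e = undefined"
      \<comment> \<open>Extensionality passes to the limit in the same way, \<open>undefined\<close>
        being a constant real number.\<close>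
      by (rule antisym; rule le[OF coord tendsto_const] le[OF tendsto_const coord])
        (use \<open>e = (x, y)\<close> e in \<open>auto simp: feasible_set_def PiE_iff extensional_def\<close>)
  qed simp
  moreover have "\<tau>' (x, y) = \<tau>' (y, x)" if "x \<in> A" "y \<in> A" "x \<noteq> y" for x y
    by (rule antisym; rule le[OF coord coord]) (use that in \<open>auto simp: feasible_set_def\<close>)
  moreover have "m' x \<le> \<tau>' (x, succ_in \<xi> x)" "\<tau>' (x, succ_in \<xi> x) \<le> 1" if "x \<in> Domain \<xi>" for x
    using that by (intro le[OF m coord] le[OF coord tendsto_const]; simp add: feasible_set_def)+
  moreover have "\<tau>' (succ_in \<xi> x, z) \<le> \<tau>' (x, z)" "\<tau>' (x, z) \<le> \<tau>' (succ_in \<xi> x, z) + m' x"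
    if "x \<in> Domain \<xi>" "z \<in> A" "z \<noteq> x" "z \<noteq> succ_in \<xi> x" for x z
    using that by (intro le[OF coord coord] le[OF coord tendsto_add[OF coord m]]; simp add: feasible_set_def)+
  ultimately show ?thesis by (simp add: feasible_set_def)
qed

text \<open>The box supplies a cluster point, and \<open>feasible_limit\<close> with constant
  margins shows that it is feasible.\<close>

lemma compact_feasible_offdiag_box: "compact (feasible_set m \<inter> offdiag_box A t r)"
  unfolding compact_filter
proof (intro allI impI)
  fix F :: "('a \<times> 'a \<Rightarrow> real) filter"
  assume "F \<noteq> bot" and ev: "\<forall>\<^sub>F \<tau> in F. \<tau> \<in> feasible_set m \<inter> offdiag_box A t r"
  moreover have "\<forall>\<^sub>F \<tau> in F. \<tau> \<in> offdiag_box A t r" using ev by eventually_elim simp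
  ultimately obtain k where k: "k \<in> offdiag_box A t r" "inf (nhds k) F \<noteq> bot"
    using compact_offdiag_box unfolding compact_filter by blast
  have "k \<in> feasible_set m"
  proof (rule feasible_limit[OF k(2)])
    show "((\<lambda>\<tau>. \<tau>) \<longlongrightarrow> k) (inf (nhds k) F)"
      by (simp add: filterlim_def)
    show "\<forall>\<^sub>F \<tau> in inf (nhds k) F. \<tau> \<in> feasible_set m"
      using filter_leD[OF inf_le2 ev] by eventually_elim simp
  qed simp
  with k show "\<exists>k\<in>feasible_set m \<inter> offdiag_box A t r. inf (nhds k) F \<noteq> bot" by blast
qed

abbreviation ones :: "'a \<times> 'a \<Rightarrow> real" where
  "ones \<equiv> (\<lambda>e\<in>offdiag A. 1)"

lemma offdiag_iff: "(x, y) \<in> offdiag A \<longleftrightarrow> x \<in> A \<and> y \<in> A \<and> x \<noteq> y"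
  by (simp add: offdiag_def)

lemma succ_step:
  assumes "x \<in> Domain \<xi>"
  shows "x \<in> A" "succ_in \<xi> x \<in> A" "x \<noteq> succ_in \<xi> x"
  using lessD[OF less_succ[OF assms]] by auto

text \<open>Row differences shrink by the factor \<open>1 - s\<close>, so the lower bound on
  \<open>m'\<close> covers them. Superdiagonal entries rise to at least
  \<open>(1 - s) * m x + s\<close>, so the upper bound on \<open>m'\<close> covers these.\<close>

lemma feasible_towards_ones:
  assumes "\<tau> \<in> feasible_set m" and "0 \<le> s" "s \<le> 1"
    and m': "\<And>x. x \<in> Domain \<xi> \<Longrightarrow> (1 - s) * m x \<le> m' x \<and> m' x \<le> (1 - s) * m x + s"
  shows "(\<lambda>e\<in>offdiag A. (1 - s) * \<tau> e + s) \<in> feasible_set m'"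
proof -
  let ?\<sigma> = "\<lambda>e\<in>offdiag A. (1 - s) * \<tau> e + s"
  have scale: "(1 - s) * c \<le> (1 - s) * d" if "c \<le> d" for c d
    using that assms(3) by (simp add: mult_left_mono)
  have "?\<sigma> (x, y) = ?\<sigma> (y, x)" if "x \<in> A" "y \<in> A" "x \<noteq> y" for x y
    using assms(1) that by (simp add: feasible_set_def offdiag_iff)
  moreover have "m' x \<le> ?\<sigma> (x, succ_in \<xi> x) \<and> ?\<sigma> (x, succ_in \<xi> x) \<le> 1"
    if x: "x \<in> Domain \<xi>" for x
  proof -
    have "m x \<le> \<tau> (x, succ_in \<xi> x)" "\<tau> (x, succ_in \<xi> x) \<le> 1"
      using assms(1) x by (auto simp: feasible_set_def)
    then have "(1 - s) * m x \<le> (1 - s) * \<tau> (x, succ_in \<xi> x)"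
      "(1 - s) * \<tau> (x, succ_in \<xi> x) \<le> (1 - s) * 1"
      by - (rule scale, assumption)+
    then show ?thesis using m'[OF x] succ_step[OF x] by (simp add: offdiag_iff)
  qed
  moreover have "?\<sigma> (succ_in \<xi> x, z) \<le> ?\<sigma> (x, z) \<and> ?\<sigma> (x, z) \<le> ?\<sigma> (succ_in \<xi> x, z) + m' x"
    if x: "x \<in> Domain \<xi>" and z: "z \<in> A" "z \<noteq> x" "z \<noteq> succ_in \<xi> x" for x z
  proof -
    have "\<tau> (succ_in \<xi> x, z) \<le> \<tau> (x, z)" "\<tau> (x, z) \<le> \<tau> (succ_in \<xi> x, z) + m x"
      using assms(1) x z by (auto simp: feasible_set_def)
    then have "(1 - s) * \<tau> (succ_in \<xi> x, z) \<le> (1 - s) * \<tau> (x, z)"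
      "(1 - s) * \<tau> (x, z) \<le> (1 - s) * (\<tau> (succ_in \<xi> x, z) + m x)"
      by - (rule scale, assumption)+
    moreover have "(1 - s) * (\<tau> (succ_in \<xi> x, z) + m x)
        = (1 - s) * \<tau> (succ_in \<xi> x, z) + (1 - s) * m x"
      by (rule distrib_left)
    ultimately show ?thesis using m'[OF x] succ_step[OF x] z by (simp add: offdiag_iff)
  qed
  ultimately show ?thesis by (simp add: feasible_set_def)
qed

lemma ones_feasible:
  assumes "\<And>x. x \<in> Domain \<xi> \<Longrightarrow> 0 \<le> m x \<and> m x \<le> 1"
  shows "ones \<in> feasible_set m"
  using assms succ_step by (auto simp: feasible_set_def offdiag_iff)

section \<open>Existence and uniqueness of the minimizer\<close>

lemma midpoint_feasible:
  assumes "\<sigma> \<in> feasible_set m" "\<tau> \<in> feasible_set m"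
  shows "(\<lambda>e\<in>offdiag A. (\<sigma> e + \<tau> e) / 2) \<in> feasible_set m"
proof -
  let ?\<mu> = "\<lambda>e\<in>offdiag A. (\<sigma> e + \<tau> e) / 2"
  have "?\<mu> (x, y) = ?\<mu> (y, x)" if "x \<in> A" "y \<in> A" "x \<noteq> y" for x y
    using assms that by (simp add: feasible_set_def offdiag_iff)
  moreover have "m x \<le> ?\<mu> (x, succ_in \<xi> x) \<and> ?\<mu> (x, succ_in \<xi> x) \<le> 1"
    if x: "x \<in> Domain \<xi>" for x
  proof -
    have "m x \<le> \<tau> (x, succ_in \<xi> x)" "\<tau> (x, succ_in \<xi> x) \<le> 1"
      "m x \<le> \<sigma> (x, succ_in \<xi> x)" "\<sigma> (x, succ_in \<xi> x) \<le> 1"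
      using assms x by (auto simp: feasible_set_def)
    then show ?thesis using succ_step[OF x] by (simp add: offdiag_iff)
  qed
  moreover have "?\<mu> (succ_in \<xi> x, z) \<le> ?\<mu> (x, z) \<and> ?\<mu> (x, z) \<le> ?\<mu> (succ_in \<xi> x, z) + m x"
    if x: "x \<in> Domain \<xi>" and z: "z \<in> A" "z \<noteq> x" "z \<noteq> succ_in \<xi> x" for x z
  proof -
    have "\<tau> (succ_in \<xi> x, z) \<le> \<tau> (x, z)" "\<tau> (x, z) \<le> \<tau> (succ_in \<xi> x, z) + m x"
      "\<sigma> (succ_in \<xi> x, z) \<le> \<sigma> (x, z)" "\<sigma> (x, z) \<le> \<sigma> (succ_in \<xi> x, z) + m x"
      using assms x z by (auto simp: feasible_set_def)
    moreover have \<mu>: "?\<mu> (x, z) = (\<sigma> (x, z) + \<tau> (x, z)) / 2"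
      "?\<mu> (succ_in \<xi> x, z) = (\<sigma> (succ_in \<xi> x, z) + \<tau> (succ_in \<xi> x, z)) / 2"
      using succ_step[OF x] z by (simp_all add: offdiag_iff)
    ultimately show ?thesis unfolding \<mu> add_divide_distrib by (intro conjI; linarith)
  qed
  ultimately show ?thesis by (simp add: feasible_set_def)
qed

text \<open>Parallelogram identity: the midpoint is feasible and cannot be better than either
  minimizer, which forces their distance to be 0.\<close>

lemma minimizer_unique:
  assumes \<sigma>: "\<sigma> \<in> feasible_set m" "\<And>\<rho>. \<rho> \<in> feasible_set m \<Longrightarrow> sqdist A t \<sigma> \<le> sqdist A t \<rho>"
    and \<tau>: "\<tau> \<in> feasible_set m" "\<And>\<rho>. \<rho> \<in> feasible_set m \<Longrightarrow> sqdist A t \<tau> \<le> sqdist A t \<rho>"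
  shows "\<sigma> = \<tau>"
proof -
  let ?\<mu> = "\<lambda>e\<in>offdiag A. (\<sigma> e + \<tau> e) / 2"
  have "(\<sigma> e - \<tau> e)\<^sup>2 = 2 * (\<sigma> e - t e)\<^sup>2 + 2 * (\<tau> e - t e)\<^sup>2 - 4 * (?\<mu> e - t e)\<^sup>2"
    if "e \<in> offdiag A" for e
    using that by (simp add: power2_eq_square field_simps)
  then have "(\<Sum>e\<in>offdiag A. (\<sigma> e - \<tau> e)\<^sup>2)
      = 2 * sqdist A t \<sigma> + 2 * sqdist A t \<tau> - 4 * sqdist A t ?\<mu>"
    by (simp add: sqdist_def sum.distrib sum_subtractf sum_distrib_left)
  also have "\<dots> \<le> 0"
    using \<sigma>(2)[OF midpoint_feasible[OF \<sigma>(1) \<tau>(1)]] \<tau>(2)[OF midpoint_feasible[OF \<sigma>(1) \<tau>(1)]]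
    by simp
  finally have "(\<Sum>e\<in>offdiag A. (\<sigma> e - \<tau> e)\<^sup>2) = 0"
    by (intro antisym sum_nonneg) auto
  then have "\<sigma> e = \<tau> e" if "e \<in> offdiag A" for e
    using that finite_offdiag[OF finite_carrier] by (simp add: sum_nonneg_eq_0_iff)
  moreover have "\<sigma> \<in> offdiag A \<rightarrow>\<^sub>E UNIV" "\<tau> \<in> offdiag A \<rightarrow>\<^sub>E UNIV"
    using \<sigma>(1) \<tau>(1) by (simp_all add: feasible_set_def)
  ultimately show ?thesis by (blast intro: PiE_ext)
qed

text \<open>Everything at least as good as the feasible point \<open>ones\<close> lies in a compact
  box, and so does \<open>ones\<close>; a minimum over the feasible part of the box is therefore
  global.\<close>

lemma minimizer_exists:
  assumes m: "\<And>x. x \<in> Domain \<xi> \<Longrightarrow> 0 \<le> m x \<and> m x \<le> 1"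
  obtains \<tau> where "\<tau> \<in> feasible_set m"
    and "\<And>\<rho>. \<rho> \<in> feasible_set m \<Longrightarrow> sqdist A t \<tau> \<le> sqdist A t \<rho>"
proof -
  let ?c = "sqdist A t ones"
  let ?K = "feasible_set m \<inter> offdiag_box A t (1 + ?c)"
  have small: "\<rho> \<in> ?K" if "\<rho> \<in> feasible_set m" "sqdist A t \<rho> \<le> ?c" for \<rho>
    using that abs_diff_le_if_sqdist_le[OF finite_carrier that(2)]
    by (auto simp: in_offdiag_box_iff) (auto simp: feasible_set_def)
  have ones: "ones \<in> ?K" using ones_feasible[OF m] by (intro small) auto
  have "continuous_on ?K (sqdist A t)"
    unfolding sqdist_def
    by (intro continuous_intros continuous_on_subset[OF continuous_on_product_coordinates]) auto
  then obtain \<tau> where \<tau>: "\<tau> \<in> ?K" "\<And>\<rho>. \<rho> \<in> ?K \<Longrightarrow> sqdist A t \<tau> \<le> sqdist A t \<rho>"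
    using continuous_attains_inf[OF compact_feasible_offdiag_box[of m t "1 + ?c"]] ones by blast
  show thesis
  proof
    show "\<tau> \<in> feasible_set m" using \<tau>(1) by simp
    show "sqdist A t \<tau> \<le> sqdist A t \<rho>" if "\<rho> \<in> feasible_set m" for \<rho>
      using \<tau>(2)[OF ones] \<tau>(2)[OF small[OF that]] by linarith
  qed
qed

text \<open>Existence and uniqueness turn the description \<open>THE\<close> in
  \<open>sigma_turnout\<close> into the actual minimizer.\<close>

lemma
  assumes m: "\<And>x. x \<in> Domain \<xi> \<Longrightarrow> 0 \<le> sigma_margin A v \<xi> x \<and> sigma_margin A v \<xi> x \<le> 1"
  shows sigma_turnout_feasible:
      "sigma_turnout A v \<xi> \<in> feasible_set (sigma_margin A v \<xi>)" (is "?\<tau> \<in> ?S")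
    and sigma_turnout_minimal: "\<rho> \<in> feasible_set (sigma_margin A v \<xi>) \<Longrightarrow>
      sqdist A (turnout v) (sigma_turnout A v \<xi>) \<le> sqdist A (turnout v) \<rho>"
proof -
  let ?f = "sqdist A (turnout v)"
  obtain \<tau> where \<tau>: "\<tau> \<in> ?S" "\<And>\<rho>. \<rho> \<in> ?S \<Longrightarrow> ?f \<tau> \<le> ?f \<rho>"
    using minimizer_exists[of "sigma_margin A v \<xi>", OF m] by blast
  have "?\<tau> = (THE \<tau>. is_arg_min ?f (\<lambda>\<tau>. \<tau> \<in> ?S) \<tau>)"
    by (simp add: sigma_turnout_def sigma_feasible_eq sqdist_eq[OF finite_carrier])
  also have "\<dots> = \<tau>"
  proof (rule the_equality)
    show "is_arg_min ?f (\<lambda>\<tau>. \<tau> \<in> ?S) \<tau>"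
      using \<tau> by (auto simp: is_arg_min_def not_less)
    show "\<sigma> = \<tau>" if "is_arg_min ?f (\<lambda>\<tau>. \<tau> \<in> ?S) \<sigma>" for \<sigma>
      using that \<tau> by (intro minimizer_unique[of \<sigma> _ "turnout v"]) (auto simp: is_arg_min_def not_less)
  qed
  finally have "?\<tau> = \<tau>" .
  with \<tau> show "?\<tau> \<in> ?S" "\<rho> \<in> ?S \<Longrightarrow> ?f ?\<tau> \<le> ?f \<rho>" by simp_all
qed

end

section \<open>Continuity of the rates\<close>

lemma tendsto_Max_image:
  fixes f :: "'b \<Rightarrow> 'c \<Rightarrow> real"
  assumes "finite I" "I \<noteq> {}" and "\<And>i. i \<in> I \<Longrightarrow> ((\<lambda>\<alpha>. f \<alpha> i) \<longlongrightarrow> g i) F"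
  shows "((\<lambda>\<alpha>. Max (f \<alpha> ` I)) \<longlongrightarrow> Max (g ` I)) F"
  using assms
proof (induction I rule: finite_ne_induct)
  case (insert i I)
  then show ?case by (simp add: tendsto_max)
qed simp

lemma tendsto_Min_image:
  fixes f :: "'b \<Rightarrow> 'c \<Rightarrow> real"
  assumes "finite I" "I \<noteq> {}" and "\<And>i. i \<in> I \<Longrightarrow> ((\<lambda>\<alpha>. f \<alpha> i) \<longlongrightarrow> g i) F"
  shows "((\<lambda>\<alpha>. Min (f \<alpha> ` I)) \<longlongrightarrow> Min (g ` I)) F"
  using assms
proof (induction I rule: finite_ne_induct)
  case (insert i I)
  then show ?case by (simp add: tendsto_min)
qed simp

lemma tendsto_turnout:
  assumes "\<And>e. e \<in> offdiag A \<Longrightarrow> ((\<lambda>\<alpha>. v \<alpha> e) \<longlongrightarrow> w e) F" and "e \<in> offdiag A"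
  shows "((\<lambda>\<alpha>. turnout (v \<alpha>) e) \<longlongrightarrow> turnout w e) F"
  using assms(2) offdiag_swap
  by (auto simp: turnout_def split: prod.split intro!: tendsto_add assms(1))

section \<open>Limits of minimizers and of rates for a fixed order\<close>

context finite_linear_order
begin

text \<open>The cluster point \<open>k\<close> is feasible by \<open>feasible_limit\<close>. For its
  optimality, each competitor \<open>\<rho>\<close> is approximated by points
  \<open>\<sigma> \<alpha>\<close> of the nearby polytopes, which cannot beat the minimizers there;
  the inequality survives in the limit.\<close>

lemma sigma_turnout_limit:
  assumes "G \<noteq> bot" and lim: "((\<lambda>\<alpha>. sigma_turnout A (v \<alpha>) \<xi>) \<longlongrightarrow> k) G"
    and v: "\<And>e. e \<in> offdiag A \<Longrightarrow> ((\<lambda>\<alpha>. v \<alpha> e) \<longlongrightarrow> w e) G"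
    and margins: "\<And>x. x \<in> Domain \<xi> \<Longrightarrow>
      ((\<lambda>\<alpha>. sigma_margin A (v \<alpha>) \<xi> x) \<longlongrightarrow> sigma_margin A w \<xi> x) G"
    and ev: "\<forall>\<^sub>F \<alpha> in G. \<forall>x\<in>Domain \<xi>. 0 \<le> sigma_margin A (v \<alpha>) \<xi> x \<and> sigma_margin A (v \<alpha>) \<xi> x \<le> 1"
    and w: "\<And>x. x \<in> Domain \<xi> \<Longrightarrow> 0 \<le> sigma_margin A w \<xi> x \<and> sigma_margin A w \<xi> x \<le> 1"
  shows "k = sigma_turnout A w \<xi>"
proof -
  let ?m = "\<lambda>\<alpha>. sigma_margin A (v \<alpha>) \<xi>" and ?m' = "sigma_margin A w \<xi>"
  let ?f = "\<lambda>\<alpha>. sigma_turnout A (v \<alpha>) \<xi>"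
  have "\<forall>\<^sub>F \<alpha> in G. ?f \<alpha> \<in> feasible_set (?m \<alpha>)"
    using ev by eventually_elim (rule sigma_turnout_feasible, blast)
  then have k: "k \<in> feasible_set ?m'"
    by (intro feasible_limit[OF assms(1) lim, where m = ?m] margins)
  have "sqdist A (turnout w) k \<le> sqdist A (turnout w) \<rho>" if \<rho>: "\<rho> \<in> feasible_set ?m'" for \<rho>
  proof -
    \<comment> \<open>\<open>feasible_towards_ones\<close> demands
      \<open>?m' x - ?m \<alpha> x \<le> s \<alpha> * ?m' x\<close> and
      \<open>?m \<alpha> x - ?m' x \<le> s \<alpha> * (1 - ?m' x)\<close>. The quotients solve these
      for one \<open>x\<close>, the sum for all. If \<open>?m' x\<close> is 0 or 1, the quotient
      with zero divisor is 0, and the inequality in question holds because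
      \<open>?m \<alpha> x\<close> lies between 0 and 1.\<close>
    define s where "s \<alpha> = (\<Sum>x\<in>Domain \<xi>.
      \<bar>?m \<alpha> x - ?m' x\<bar> / ?m' x + \<bar>?m \<alpha> x - ?m' x\<bar> / (1 - ?m' x))" for \<alpha>
    define \<sigma> where "\<sigma> \<alpha> = (\<lambda>e\<in>offdiag A. (1 - s \<alpha>) * \<rho> e + s \<alpha>)" for \<alpha>
    have "(s \<longlongrightarrow> (\<Sum>x\<in>Domain \<xi>. \<bar>?m' x - ?m' x\<bar> * inverse (?m' x)
        + \<bar>?m' x - ?m' x\<bar> * inverse (1 - ?m' x))) G"
      \<comment> \<open>The divisors do not vary with \<alpha>; as constant factors
        \<open>inverse\<close> they cause no difficulty even when they vanish.\<close>
      unfolding s_def divide_inverse by (intro tendsto_intros margins)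
    then have s: "(s \<longlongrightarrow> 0) G" by simp
    have "\<forall>\<^sub>F \<alpha> in G. s \<alpha> < 1" using order_tendstoD(2)[OF s] by simp
    with ev have "\<forall>\<^sub>F \<alpha> in G. sqdist A (turnout (v \<alpha>)) (?f \<alpha>) \<le> sqdist A (turnout (v \<alpha>)) (\<sigma> \<alpha>)"
    proof eventually_elim
      case (elim \<alpha>)
      then have m: "0 \<le> ?m \<alpha> x \<and> ?m \<alpha> x \<le> 1" if "x \<in> Domain \<xi>" for x using that by blast
      have s_nonneg: "0 \<le> s \<alpha>" unfolding s_def using w by (intro sum_nonneg) auto
      have "(1 - s \<alpha>) * ?m' x \<le> ?m \<alpha> x \<and> ?m \<alpha> x \<le> (1 - s \<alpha>) * ?m' x + s \<alpha>"
        if x: "x \<in> Domain \<xi>" for x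
      proof -
        let ?d = "\<bar>?m \<alpha> x - ?m' x\<bar>"
        have "?d / ?m' x + ?d / (1 - ?m' x) \<le> s \<alpha>"
          unfolding s_def using w x finite_Domain[OF finite_order]
          by (intro member_le_sum[where f = "\<lambda>x. \<bar>?m \<alpha> x - ?m' x\<bar> / ?m' x + \<bar>?m \<alpha> x - ?m' x\<bar> / (1 - ?m' x)"]) auto
        moreover have "0 \<le> ?d / ?m' x" "0 \<le> ?d / (1 - ?m' x)" using w[OF x] by auto
        ultimately have le: "?d / ?m' x \<le> s \<alpha>" "?d / (1 - ?m' x) \<le> s \<alpha>" by linarith+
        have "?m' x - ?m \<alpha> x \<le> s \<alpha> * ?m' x"
        proof (cases "?m' x = 0")
          case False
          then have "?d \<le> s \<alpha> * ?m' x" using le(1) w[OF x] by (simp add: pos_divide_le_eq)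
          then show ?thesis by linarith
        qed (use m[OF x] in simp)
        moreover have "?m \<alpha> x - ?m' x \<le> s \<alpha> * (1 - ?m' x)"
        proof (cases "?m' x = 1")
          case False
          then have "?d \<le> s \<alpha> * (1 - ?m' x)" using le(2) w[OF x] by (simp add: pos_divide_le_eq)
          then show ?thesis by linarith
        qed (use m[OF x] in simp)
        ultimately show ?thesis by (simp add: algebra_simps)
      qed
      then have "\<sigma> \<alpha> \<in> feasible_set (?m \<alpha>)"
        unfolding \<sigma>_def using \<rho> s_nonneg elim(2) by (intro feasible_towards_ones) auto
      then show ?case using m by (intro sigma_turnout_minimal) auto
    qed
    moreover have \<sigma>: "((\<lambda>\<alpha>. \<sigma> \<alpha> e) \<longlongrightarrow> \<rho> e) G" if "e \<in> offdiag A" for e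
    proof -
      have "((\<lambda>\<alpha>. (1 - s \<alpha>) * \<rho> e + s \<alpha>) \<longlongrightarrow> (1 - 0) * \<rho> e + 0) G"
        by (intro tendsto_intros s)
      then show ?thesis using that by (simp add: \<sigma>_def)
    qed
    moreover have t: "((\<lambda>\<alpha>. turnout (v \<alpha>) e) \<longlongrightarrow> turnout w e) G" if "e \<in> offdiag A" for e
      using tendsto_turnout[of A v w G, OF v that] .
    have "((\<lambda>\<alpha>. sqdist A (turnout (v \<alpha>)) (\<sigma> \<alpha>)) \<longlongrightarrow> sqdist A (turnout w) \<rho>) G"
      by (intro tendsto_sqdist t \<sigma>)
    moreover have "((\<lambda>\<alpha>. sqdist A (turnout (v \<alpha>)) (?f \<alpha>)) \<longlongrightarrow> sqdist A (turnout w) k) G"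
      by (intro tendsto_sqdist t tendsto_fun_coordinate[OF lim])
    ultimately show ?thesis by (intro tendsto_le[OF assms(1)])
  qed
  then show ?thesis
    using k by (intro minimizer_unique[of k ?m' "turnout w"]
      sigma_turnout_feasible[OF w] sigma_turnout_minimal[OF w])
qed

lemma tendsto_sigma_turnout:
  assumes v: "\<And>e. e \<in> offdiag A \<Longrightarrow> ((\<lambda>\<alpha>. v \<alpha> e) \<longlongrightarrow> w e) F"
    and margins: "\<And>x. x \<in> Domain \<xi> \<Longrightarrow>
      ((\<lambda>\<alpha>. sigma_margin A (v \<alpha>) \<xi> x) \<longlongrightarrow> sigma_margin A w \<xi> x) F"
    and ev: "\<forall>\<^sub>F \<alpha> in F. \<forall>x\<in>Domain \<xi>. 0 \<le> sigma_margin A (v \<alpha>) \<xi> x \<and> sigma_margin A (v \<alpha>) \<xi> x \<le> 1"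
    and w: "\<And>x. x \<in> Domain \<xi> \<Longrightarrow> 0 \<le> sigma_margin A w \<xi> x \<and> sigma_margin A w \<xi> x \<le> 1"
  shows "((\<lambda>\<alpha>. sigma_turnout A (v \<alpha>) \<xi>) \<longlongrightarrow> sigma_turnout A w \<xi>) F"
proof (rule tendsto_if_cluster_points_eq)
  let ?c = "sqdist A (turnout w) ones"
  \<comment> \<open>The radius: the objective at \<open>ones\<close> is eventually below
    \<open>1 + ?c\<close>, \<open>abs_diff_le_if_sqdist_le\<close> adds 1, and the turnouts differ
    from their limits by less than 1.\<close>
  let ?K = "offdiag_box A (turnout w) (3 + ?c)"
  show "compact ?K" by (rule compact_offdiag_box)
  have "((\<lambda>\<alpha>. sqdist A (turnout (v \<alpha>)) ones) \<longlongrightarrow> ?c) F"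
    by (intro tendsto_sqdist tendsto_turnout[OF v]) auto
  then have "\<forall>\<^sub>F \<alpha> in F. sqdist A (turnout (v \<alpha>)) ones < 1 + ?c"
    by (rule order_tendstoD(2)) simp
  moreover have "\<forall>\<^sub>F \<alpha> in F. dist (turnout (v \<alpha>) e) (turnout w e) < 1" if "e \<in> offdiag A" for e
    using tendstoD[OF tendsto_turnout[of A v w F, OF v that], of 1] by simp
  then have "\<forall>\<^sub>F \<alpha> in F. \<forall>e\<in>offdiag A. dist (turnout (v \<alpha>) e) (turnout w e) < 1"
    using finite_offdiag[OF finite_carrier] by (intro eventually_ball_finite) auto
  ultimately show "\<forall>\<^sub>F \<alpha> in F. sigma_turnout A (v \<alpha>) \<xi> \<in> ?K"
    using ev
  proof eventually_elim
    case (elim \<alpha>)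
    let ?\<tau> = "sigma_turnout A (v \<alpha>) \<xi>"
    have m: "0 \<le> sigma_margin A (v \<alpha>) \<xi> x \<and> sigma_margin A (v \<alpha>) \<xi> x \<le> 1" if "x \<in> Domain \<xi>" for x
      using elim(3) that by blast
    have "sqdist A (turnout (v \<alpha>)) ?\<tau> \<le> 1 + ?c"
      using sigma_turnout_minimal[OF m ones_feasible[OF m]] elim(1) by simp
    then have "\<bar>?\<tau> e - turnout w e\<bar> \<le> 3 + ?c" if "e \<in> offdiag A" for e
      using abs_diff_le_if_sqdist_le[OF finite_carrier _ that, of "turnout (v \<alpha>)" ?\<tau> "1 + ?c"]
        elim(2)[rule_format, OF that] unfolding dist_real_def by linarith
    moreover have "?\<tau> \<in> offdiag A \<rightarrow>\<^sub>E UNIV"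
      using sigma_turnout_feasible[OF m] by (simp add: feasible_set_def)
    ultimately show ?case by (simp add: in_offdiag_box_iff)
  qed
  fix G k
  assume "G \<noteq> bot" and le: "G \<le> F" and lim: "((\<lambda>\<alpha>. sigma_turnout A (v \<alpha>) \<xi>) \<longlongrightarrow> k) G"
  show "k = sigma_turnout A w \<xi>"
    using \<open>G \<noteq> bot\<close> lim tendsto_mono[OF le v] tendsto_mono[OF le margins] filter_leD[OF le ev] w
    by (rule sigma_turnout_limit)
qed

lemma tendsto_sigma_margin:
  assumes "\<And>e. e \<in> offdiag A \<Longrightarrow> ((\<lambda>\<alpha>. v \<alpha> e) \<longlongrightarrow> w e) F" and "x \<in> Domain \<xi>"
  shows "((\<lambda>\<alpha>. sigma_margin A (v \<alpha>) \<xi> x) \<longlongrightarrow> sigma_margin A w \<xi> x) F"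
  unfolding sigma_margin_eq
proof (rule tendsto_Min_image)
  show "finite (sigma_pairs x)" using assms(2) by (rule finite_sigma_pairs)
  show "sigma_pairs x \<noteq> {}" using succ_in_sigma_pairs by blast
  show "((\<lambda>\<alpha>. indirect_margin A (v \<alpha>) e) \<longlongrightarrow> indirect_margin A w e) F"
    if "e \<in> sigma_pairs x" for e
    using that sigma_pairs_subset[OF assms(2)] subset_offdiag
    by (intro tendsto_indirect_margin[OF finite_carrier assms(1)]) auto
qed

lemma sigma_margin_range:
  assumes "admissible_order A v \<xi>" and "\<And>e. e \<in> offdiag A \<Longrightarrow> v e \<in> {0..1}"
    and x: "x \<in> Domain \<xi>"
  shows "0 \<le> sigma_margin A v \<xi> x \<and> sigma_margin A v \<xi> x \<le> 1"
proof -
  have "indirect_margin A v (x, succ_in \<xi> x) \<le> 1"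
    using less_succ[OF x] subset_offdiag
    by (intro indirect_margin_le_1[OF finite_carrier assms(2)]) auto
  then show ?thesis
    using sigma_margin_le[OF x, of v] sigma_margin_nonneg[OF assms(1) x] by simp
qed

text \<open>With \<open>\<xi>\<close> fixed, the index sets of all minima and maxima are fixed, so
  apart from the projection only continuous operations are composed. Admissibility keeps the margins
  between 0 and 1, both near the limit and at it.\<close>

lemma tendsto_rate_wrt:
  assumes v: "\<And>e. e \<in> offdiag A \<Longrightarrow> ((\<lambda>\<alpha>. v \<alpha> e) \<longlongrightarrow> w e) F"
    and ev: "\<forall>\<^sub>F \<alpha> in F. admissible_order A (v \<alpha>) \<xi> \<and> (\<forall>e\<in>offdiag A. v \<alpha> e \<in> {0..1})"
    and w: "admissible_order A w \<xi>" "\<And>e. e \<in> offdiag A \<Longrightarrow> w e \<in> {0..1}"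
    and x: "x \<in> A"
  shows "((\<lambda>\<alpha>. rate_wrt A (v \<alpha>) \<xi> x) \<longlongrightarrow> rate_wrt A w \<xi> x) F"
proof -
  note margin = tendsto_sigma_margin[OF v]
  have range: "\<forall>\<^sub>F \<alpha> in F. \<forall>x\<in>Domain \<xi>.
      0 \<le> sigma_margin A (v \<alpha>) \<xi> x \<and> sigma_margin A (v \<alpha>) \<xi> x \<le> 1"
    using ev
  proof eventually_elim
    case (elim \<alpha>)
    then show ?case using sigma_margin_range[of "v \<alpha>"] by blast
  qed
  have "((\<lambda>\<alpha>. sigma_turnout A (v \<alpha>) \<xi>) \<longlongrightarrow> sigma_turnout A w \<xi>) F"
    using v margin range sigma_margin_range[OF w] by (rule tendsto_sigma_turnout)
  note turnout = tendsto_fun_coordinate[OF this]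
  have forward: "((\<lambda>\<alpha>. forward_score A (v \<alpha>) \<xi> p) \<longlongrightarrow> forward_score A w \<xi> p) F"
    and backward: "((\<lambda>\<alpha>. backward_score A (v \<alpha>) \<xi> p) \<longlongrightarrow> backward_score A w \<xi> p) F"
    if "p \<in> Domain \<xi>" for p
    unfolding forward_score_def backward_score_def
    using that by (intro tendsto_intros turnout margin; simp)+
  have "((\<lambda>\<alpha>. projected_score A (v \<alpha>) \<xi> (x, y)) \<longlongrightarrow> projected_score A w \<xi> (x, y)) F"
    if y: "y \<in> A - {x}" for y
  proof (cases "(x, y) \<in> \<xi>")
    case True
    then show ?thesis
      unfolding projected_score_eq
      using finite_steps first_in_steps[OF True] steps_subset
      by (auto intro!: tendsto_Max_image forward intro: subsetD[OF steps_subset])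
  next
    case False
    then have "(y, x) \<in> \<xi>" using linear x y by blast
    then show ?thesis
      unfolding projected_score_eq
      using False finite_steps first_in_steps[of y x] steps_subset
      by (auto intro!: tendsto_Min_image backward intro: subsetD[OF steps_subset])
  qed
  then show ?thesis unfolding rate_wrt_def by (intro tendsto_intros)
qed

end

section \<open>Pasting the admissible orders together\<close>

theorem corollary6p2:
  fixes A :: "'a set" and V :: "'m::finite \<Rightarrow> 'a \<times> 'a \<Rightarrow> real" and x :: 'a
  assumes "finite A" and "A \<noteq> {}"
    and "\<And>k. V k \<in> llull_matrices A"
    and "x \<in> A"
  shows "continuous_on (prob_simplex :: (real ^ 'm) set)
           (\<lambda>\<alpha>. rank_like_rate A (collective_matrix A V \<alpha>) x)"
proof -
  let ?v = "collective_matrix A V"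
  let ?\<Delta> = "prob_simplex :: (real ^ 'm) set"
  define C where "C \<xi> = {\<alpha> \<in> ?\<Delta>. admissible_order A (?v \<alpha>) \<xi>}" for \<xi>
  have V: "0 \<le> V k e" "V k e \<le> 1" if "e \<in> offdiag A" for k e
    using assms(3)[of k] that by (auto simp: llull_matrices_def PiE_iff)
  have range: "?v \<alpha> e \<in> {0..1}" if \<alpha>: "\<alpha> \<in> ?\<Delta>" and e: "e \<in> offdiag A" for \<alpha> e
  proof -
    have "(\<Sum>k\<in>UNIV. \<alpha> $ k * V k e) \<le> (\<Sum>k\<in>UNIV. \<alpha> $ k * 1)"
      using \<alpha> V[OF e] by (intro sum_mono mult_left_mono) (auto simp: prob_simplex_def)
    moreover have "0 \<le> (\<Sum>k\<in>UNIV. \<alpha> $ k * V k e)"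
      using \<alpha> V[OF e] by (intro sum_nonneg mult_nonneg_nonneg) (auto simp: prob_simplex_def)
    ultimately show ?thesis using \<alpha> e by (simp add: collective_matrix_def prob_simplex_def)
  qed
  have cont: "continuous_on UNIV (\<lambda>\<alpha>. ?v \<alpha> e)" if "e \<in> offdiag A" for e
    using that by (simp add: collective_matrix_def) (intro continuous_intros)
  then have lim: "((\<lambda>\<alpha>. ?v \<alpha> e) \<longlongrightarrow> ?v \<alpha>' e) (at \<alpha>' within S)" if "e \<in> offdiag A" for e \<alpha>' S
    using that continuous_on_subset[OF cont[OF that], of "insert \<alpha>' S"]
    by (auto simp: continuous_on_def intro: tendsto_within_subset)
  have feasible: "sigma_turnout A (?v \<alpha>) \<xi> \<in> sigma_feasible A (?v \<alpha>) \<xi>"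
    if "\<alpha> \<in> ?\<Delta>" "admissible_order A (?v \<alpha>) \<xi>" for \<alpha> \<xi>
  proof -
    interpret finite_linear_order A \<xi> using assms(1) that(2) by (rule admissible_imp_linear)
    show ?thesis
      unfolding sigma_feasible_eq
      by (intro sigma_turnout_feasible sigma_margin_range that range)
  qed
  \<comment> \<open>\<open>rank_like_rate\<close> chooses its order anew for each \<alpha>;
    independence of the choice replaces it on all of \<open>C \<xi>\<close> by the one order
    \<open>\<xi>\<close>.\<close>
  have rate: "rank_like_rate A (?v \<alpha>) x = rate_wrt A (?v \<alpha>) \<xi> x" if "\<alpha> \<in> C \<xi>" for \<alpha> \<xi>
  proof -
    have "admissible_order A (?v \<alpha>) (SOME \<xi>. admissible_order A (?v \<alpha>) \<xi>)"
      using ex_admissible_order[OF assms(1)] by (rule someI_ex)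
    then show ?thesis
      unfolding rank_like_rate_def using that feasible[of \<alpha>]
      by (intro rate_wrt_admissible_unique assms) (auto simp: C_def)
  qed
  have "continuous_on (C \<xi>) (\<lambda>\<alpha>. rank_like_rate A (?v \<alpha>) x)" for \<xi>
    unfolding continuous_on_def
  proof
    fix \<alpha>' assume \<alpha>': "\<alpha>' \<in> C \<xi>"
    then interpret finite_linear_order A \<xi>
      using assms(1) by (auto simp: C_def intro: admissible_imp_linear)
    have ev: "\<forall>\<^sub>F \<alpha> in at \<alpha>' within C \<xi>. \<alpha> \<in> C \<xi>"
      by (simp add: eventually_at_filter)
    have "((\<lambda>\<alpha>. rate_wrt A (?v \<alpha>) \<xi> x) \<longlongrightarrow> rate_wrt A (?v \<alpha>') \<xi> x) (at \<alpha>' within C \<xi>)"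
    proof (rule tendsto_rate_wrt[OF lim])
      show "\<forall>\<^sub>F \<alpha> in at \<alpha>' within C \<xi>. admissible_order A (?v \<alpha>) \<xi> \<and> (\<forall>e\<in>offdiag A. ?v \<alpha> e \<in> {0..1})"
        using ev by eventually_elim (use range in \<open>auto simp: C_def\<close>)
    qed (use \<alpha>' range assms in \<open>auto simp: C_def\<close>)
    then show "((\<lambda>\<alpha>. rank_like_rate A (?v \<alpha>) x) \<longlongrightarrow> rank_like_rate A (?v \<alpha>') x)
        (at \<alpha>' within C \<xi>)"
      unfolding rate[OF \<alpha>']
      by (rule Lim_transform_eventually) (use ev rate in \<open>auto elim: eventually_mono\<close>)
  qed
  moreover have "closed (C \<xi>)" for \<xi>
  proof (cases "\<xi> \<subseteq> offdiag A \<and> trans \<xi> \<and> total_on A \<xi>")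
    case True
    have "indirect_comparison A w \<subseteq> \<xi> \<longleftrightarrow> (\<forall>e\<in>offdiag A - \<xi>. indirect_margin A w e \<le> 0)" for w
      unfolding subset_eq Ball_def indirect_comparison_def not_le[symmetric] mem_Collect_eq Diff_iff
      by blast
    with True have "C \<xi> = ?\<Delta> \<inter> (\<Inter>e\<in>offdiag A - \<xi>. {\<alpha>. indirect_margin A (?v \<alpha>) e \<le> 0})"
      by (auto simp: C_def admissible_order_def)
    moreover have "closed ?\<Delta>"
      unfolding prob_simplex_def
      by (intro closed_Collect_conj closed_Collect_all closed_Collect_le closed_Collect_eq
          continuous_intros)
    moreover have "closed {\<alpha>. indirect_margin A (?v \<alpha>) e \<le> 0}" if "e \<in> offdiag A" for e
    proof (rule closed_Collect_le)
      show "continuous_on UNIV (\<lambda>\<alpha>. indirect_margin A (?v \<alpha>) e)"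
        unfolding continuous_on_def
        by (intro ballI tendsto_indirect_margin[OF assms(1) _ that] lim)
    qed simp
    ultimately show ?thesis
      by (simp only:) (intro closed_Int closed_INT ballI; simp only: Diff_iff)
  next
    case False
    \<comment> \<open>Sets of pairs that are not strict total orders contribute the empty set, so
      the union below can run over the whole finite power set.\<close>
    then have "C \<xi> = {}" by (auto simp: C_def admissible_order_def)
    then show ?thesis by simp
  qed
  \<comment> \<open>Pasting over finitely many closed sets; agreement on the overlaps is automatic,
    as the restrictions come from one function.\<close>
  moreover have "finite (Pow (offdiag A))" using finite_offdiag[OF assms(1)] by simp
  ultimately have "continuous_on (\<Union>\<xi>\<in>Pow (offdiag A). C \<xi>) (\<lambda>\<alpha>. rank_like_rate A (?v \<alpha>) x)"
    by (intro continuous_on_closed_Union)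
  moreover have "(\<Union>\<xi>\<in>Pow (offdiag A). C \<xi>) = ?\<Delta>"
  proof
    show "?\<Delta> \<subseteq> (\<Union>\<xi>\<in>Pow (offdiag A). C \<xi>)"
    proof
      fix \<alpha> assume "\<alpha> \<in> ?\<Delta>"
      moreover obtain \<xi> where "admissible_order A (?v \<alpha>) \<xi>"
        using ex_admissible_order[OF assms(1)] by blast
      ultimately show "\<alpha> \<in> (\<Union>\<xi>\<in>Pow (offdiag A). C \<xi>)"
        by (auto simp: C_def admissible_order_def)
    qed
  qed (auto simp: C_def)
  ultimately show ?thesis by simp
qed

end
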